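(* Let $d\ge 3$ and let $\Pi$ be an arbitrary $\mathbf 0$-symmetric parallelepiped in $\mathbb R^d$, with pseudo-compound parallelepiped $\Pi^\ast$. Suppose that \[ \mu_1(\Pi^\ast,\mathbb Z^d)\le 1\quad\text{and}\quad \mu_1(\Pi,\mathbb Z^d)>1. \] Then \[ \mu_2(\Pi,\mathbb Z^d)\le c_d, \] where $c_d$ is the positive root of the polynomial $t^{2(d-1)}-(d-1)t^2-1$.
   Context: Successive minima: for a convex body $M\subset\mathbb R^d$ symmetric with respect to the origin and a $d$-dimensional (full rank) lattice $\Lambda\subset\mathbb R^d$, the $k$-th successive minimum $\mu_k(M,\Lambda)$ is the minimal positive $\mu$ such that $\mu M$ contains $k$ linearly independent points of $\Lambda$. Pseudo-compound parallelepiped: every $\mathbf 0$-symmetric (closed, non-degenerate) parallelepiped in $\mathbb R^d$ can be written as $\Pi=\{\mathbf z\in\mathbb R^d : |h_i(\mathbf z)|\le\eta_i,\ i=1,\ldots,d\}$ with positive numbers $\eta_1,\ldots,\eta_d$ and linear forms $h_1,\ldots,h_d$ on $\mathbb R^d$ whose coefficient matrix $H$ (rows are the forms) has $\det H=1$. Let $h_1^\ast,\ldots,h_d^\ast$ be the dual set of linear forms, i.e. $\langle h_i,h_j^\ast\rangle=\delta_{ij}$ where forms are identified with their coefficient vectors and $\langle\cdot,\cdot\rangle$ is the standard inner product. The pseudo-compound of $\Pi$ is \[ \Pi^\ast=\Big\{\mathbf z\in\mathbb R^d : |h_i^\ast(\mathbf z)|\le\frac1{\eta_i}\prod_{j=1}^d\eta_j,\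 i=1,\ldots,d\Big\}. \] *)

theory Defs
  imports "HOL-Analysis.Analysis"
begin

definition integer_lattice :: "(real ^ 'n) set" where
  "integer_lattice = {x. \<forall>i. x $ i \<in> \<int>}"

text \<open>
  For a compact convex body containing the origin in its interior, a full-rank lattice and
  \<open>1 \<le> k \<le> d\<close>, the minimum exists. For other arguments the value is unspecified.
\<close>

definition successive_minimum ::
    "nat \<Rightarrow> (real ^ 'n) set \<Rightarrow> (real ^ 'n) set \<Rightarrow> real" where
  "successive_minimum k M L =
     (LEAST \<mu>. 0 < \<mu> \<and>
        (\<exists>S. S \<subseteq> (*\<^sub>R) \<mu> ` M \<inter> L \<and> card S = k \<and> independent S))"

definition symmetric_parallelepiped :: "(real ^ 'n) set \<Rightarrow> bool" where
  "symmetric_parallelepiped P \<longleftrightarrow>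
     (\<exists>v :: 'n \<Rightarrow> real ^ 'n. inj v \<and> independent (range v) \<and>
        P = {\<Sum>i\<in>UNIV. t i *\<^sub>R v i | t. \<forall>i. \<bar>t i\<bar> \<le> 1})"

text \<open>The rows of \<open>H\<close> are the coefficient vectors of the linear forms.\<close>

definition form_body :: "real ^ 'n ^ 'n \<Rightarrow> real ^ 'n \<Rightarrow> (real ^ 'n) set" where
  "form_body H \<eta> = {z. \<forall>i. \<bar>H $ i \<bullet> z\<bar> \<le> \<eta> $ i}"

definition dual_forms :: "real ^ 'n ^ 'n \<Rightarrow> real ^ 'n ^ 'n \<Rightarrow> bool" where
  "dual_forms H H' \<longleftrightarrow> (\<forall>i j. H $ i \<bullet> H' $ j = (if i = j then 1 else 0))"

text \<open>
  The pseudo-compound is a relation between sets: a parallelepiped determines its forms only up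
  to order and scaling. Existence of \<open>Q\<close> for every \<open>P\<close> is the lemma
  \<open>pseudo_compound_exists\<close> below.
\<close>

definition is_pseudo_compound :: "(real ^ 'n) set \<Rightarrow> (real ^ 'n) set \<Rightarrow> bool" where
  "is_pseudo_compound P Q \<longleftrightarrow>
     (\<exists>H \<eta> H'. det H = 1 \<and> (\<forall>i. 0 < \<eta> $ i) \<and> P = form_body H \<eta> \<and> dual_forms H H' \<and>
        Q = form_body H' (\<chi> i. 1 / \<eta> $ i * (\<Prod>j\<in>UNIV. \<eta> $ j)))"

definition root_const :: "nat \<Rightarrow> real" where
  "root_const d = (THE t. 0 < t \<and> t ^ (2 * (d - 1)) - (real d - 1) * t\<^sup>2 - 1 = 0)"

lemma dual_forms_exists:
  fixes H :: "real ^ 'n ^ 'n"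
  assumes "det H = 1"
  shows "\<exists>H'. dual_forms H H'"
proof -
  have "invertible H" using assms by (simp add: invertible_det_nz)
  then obtain B where B: "H ** B = mat 1" unfolding invertible_def by blast
  have "H $ i \<bullet> transpose B $ j = (if i = j then 1 else 0)" for i j
  proof -
    have "H $ i \<bullet> transpose B $ j = (H ** B) $ i $ j"
      by (simp add: matrix_matrix_mult_def transpose_def inner_vec_def)
    then show ?thesis using B by (simp add: mat_def)
  qed
  then show ?thesis unfolding dual_forms_def by blast
qed

lemma symmetric_parallelepiped_form_body:
  fixes P :: "(real ^ 'n) set"
  assumes "symmetric_parallelepiped P"
  shows "\<exists>H \<eta>. det H = 1 \<and> (\<forall>i. 0 < \<eta> $ i) \<and> P = form_body H \<eta>"
proof -
  obtain v :: "'n \<Rightarrow> real ^ 'n" where inj: "inj v" and ind: "independent (range v)"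
    and P: "P = {\<Sum>i\<in>UNIV. t i *\<^sub>R v i | t. \<forall>i. \<bar>t i\<bar> \<le> 1}"
    using assms unfolding symmetric_parallelepiped_def by blast
  define V :: "real ^ 'n ^ 'n" where "V = transpose (\<chi> i. v i)"
  have Vmul: "V *v x = (\<Sum>i\<in>UNIV. x $ i *\<^sub>R v i)" for x
    by (simp add: V_def matrix_vector_mult_def transpose_def vec_eq_iff mult.commute)
  have "x = 0" if "V *v x = 0" for x
  proof -
    have "(\<Sum>w\<in>range v. x $ (inv v w) *\<^sub>R w) = 0"
      using that inj by (simp add: Vmul sum.reindex)
    then have "\<forall>w\<in>range v. x $ (inv v w) = 0"
      using ind independentD[OF ind _ order_refl] by fastforce
    then show ?thesis using inj by (simp add: vec_eq_iff)
  qed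
  then obtain W where WV: "W ** V = mat 1"
    using matrix_left_invertible_ker[of V] by blast
  then have VW: "V ** W = mat 1" by (simp add: matrix_left_right_inverse)
  have dW: "det W \<noteq> 0" using WV VW invertible_def invertible_det_nz by blast
  obtain k :: 'n where True by simp
  define c where "c i = (if i = k then 1 / det W else 1)" for i
  define H :: "real ^ 'n ^ 'n" where "H = (\<chi> i. c i *s W $ i)"
  define \<eta> :: "real ^ 'n" where "\<eta> = (\<chi> i. \<bar>c i\<bar>)"
  have c0: "c i \<noteq> 0" for i using dW by (simp add: c_def)
  have "det H = (\<Prod>i\<in>UNIV. c i) * det (\<chi> i. W $ i)"
    unfolding H_def by (rule det_rows_mul)
  also have "(\<Prod>i\<in>UNIV. c i) = 1 / det W"
    by (simp add: c_def)
  finally have dH: "det H = 1" using dW by simp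
  have W_inner: "W $ i \<bullet> z = (W *v z) $ i" for i z
    by (simp add: matrix_vector_mult_def inner_vec_def)
  have H_inner: "\<bar>H $ i \<bullet> z\<bar> \<le> \<eta> $ i \<longleftrightarrow> \<bar>(W *v z) $ i\<bar> \<le> 1" for i z
    using c0[of i] by (simp add: H_def \<eta>_def W_inner scalar_mult_eq_scaleR abs_mult
        flip: W_inner)
  have "P = form_body H \<eta>"
  proof (intro set_eqI iffI)
    fix z assume "z \<in> P"
    then obtain t where z: "z = (\<Sum>i\<in>UNIV. t i *\<^sub>R v i)" and t: "\<forall>i. \<bar>t i\<bar> \<le> 1"
      unfolding P by blast
    have "z = V *v (\<chi> i. t i)" by (simp add: z Vmul)
    then have "W *v z = (\<chi> i. t i)" by (simp add: matrix_vector_mul_assoc WV)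
    then show "z \<in> form_body H \<eta>" using t by (simp add: form_body_def H_inner)
  next
    fix z assume "z \<in> form_body H \<eta>"
    then have *: "\<forall>i. \<bar>(W *v z) $ i\<bar> \<le> 1" by (simp add: form_body_def H_inner)
    have "z = V *v (W *v z)" by (simp add: matrix_vector_mul_assoc VW)
    then have "z = (\<Sum>i\<in>UNIV. (W *v z) $ i *\<^sub>R v i)" by (simp only: Vmul)
    then show "z \<in> P" unfolding P using * by blast
  qed
  moreover have "\<forall>i. 0 < \<eta> $ i" using c0 by (simp add: \<eta>_def)
  ultimately show ?thesis using dH by blast
qed

lemma pseudo_compound_exists:
  assumes "symmetric_parallelepiped P"
  shows "\<exists>Q. is_pseudo_compound P Q"
  using symmetric_parallelepiped_form_body[OF assms] dual_forms_exists
  unfolding is_pseudo_compound_def by metis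

lemma root_const_ex1:
  assumes d: "3 \<le> d"
  shows "\<exists>!t::real. 0 < t \<and> t ^ (2 * (d - 1)) - (real d - 1) * t\<^sup>2 - 1 = 0"
proof -
  define f where "f t = t ^ (2 * (d - 1)) - (real d - 1) * t\<^sup>2 - 1" for t :: real
  define g where "g t = t ^ (2 * (d - 2)) - 1 / t\<^sup>2" for t :: real
  have exp_eq: "2 * (d - 1) = 2 * (d - 2) + 2" using d by simp
  have fg: "f t = t\<^sup>2 * (g t - (real d - 1))" if "0 < t" for t
    using that unfolding f_def g_def exp_eq power_add by (simp add: field_simps)
  have g_mono: "g s < g t" if "0 < s" "s < t" for s t
  proof -
    have "s ^ (2 * (d - 2)) \<le> t ^ (2 * (d - 2))" using that by (intro power_mono) auto
    moreover have "1 / t\<^sup>2 < 1 / s\<^sup>2"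
      using that by (intro divide_strict_left_mono power_strict_mono) auto
    ultimately show ?thesis by (simp add: g_def)
  qed
  have "real d ^ 4 \<le> real d ^ (2 * (d - 1))" using d by (intro power_increasing) auto
  moreover have "real d ^ 4 \<ge> (real d - 1) * (real d)\<^sup>2 + 1"
  proof -
    have "(real d)\<^sup>2 \<ge> real d" "(real d)\<^sup>2 \<ge> 1"
      using d by (auto intro: self_le_power one_le_power)
    then have "(real d)\<^sup>2 * (real d)\<^sup>2 \<ge> real d * (real d)\<^sup>2" by (intro mult_right_mono) auto
    then show ?thesis using \<open>(real d)\<^sup>2 \<ge> 1\<close>
      by (simp add: algebra_simps power4_eq_xxxx power2_eq_square)
  qed
  ultimately have "0 \<le> f (real d)" by (simp add: f_def)
  moreover have "f 0 \<le> 0" using d by (simp add: f_def power_0_left)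
  moreover have "continuous_on {0..real d} f"
    unfolding f_def by (intro continuous_intros)
  ultimately obtain t where t: "0 \<le> t" "f t = 0"
    using IVT'[of f 0 0 "real d"] by auto
  have "f 0 \<noteq> 0" using d by (simp add: f_def power_0_left)
  then have "0 < t" using t by (cases "t = 0") auto
  have g_eq: "g s = real d - 1" if "0 < s" "f s = 0" for s
  proof -
    have "s\<^sup>2 * (g s - (real d - 1)) = 0" using fg[OF that(1)] that(2) by metis
    moreover have "s\<^sup>2 \<noteq> 0" using that(1) by simp
    ultimately have "g s - (real d - 1) = 0" using mult_eq_0_iff by blast
    then show ?thesis by linarith
  qed
  have uniq: "s = t" if "0 < s" "f s = 0" for s
    using g_eq[OF that] g_eq[OF \<open>0 < t\<close> t(2)] g_mono[OF that(1), of t] g_mono[OF \<open>0 < t\<close>, of s]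
    by linarith
  have "\<exists>!t. 0 < t \<and> f t = 0"
    using \<open>0 < t\<close> t(2) uniq by blast
  then show ?thesis unfolding f_def .
qed

end

theory Submission
  imports Defs
begin

text \<open>
  Write \<open>P\<close> as \<open>\<bar>H $ i \<bullet> z\<bar> \<le> \<eta> $ i\<close>, put \<open>d = CARD('n)\<close>, and let \<open>v\<close> be a nonzero integer point of the
  pseudo-compound \<open>Q\<close>. The proof looks for integer points of dilates of \<open>P\<close> in the hyperplane
  orthogonal to \<open>v\<close>. In the coordinates \<open>(H $ i \<bullet> z) / \<eta> $ i\<close> the body \<open>P\<close> is a cube, and the condition
  \<open>v \<in> Q\<close> says that all coefficients of the hyperplane are bounded by the product of the \<open>\<eta> $ j\<close>. By
  the theorem of Hadwiger and Hensley, a central hyperplane section of a cube of side 2 has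
  volume at least \<open>2 ^ (d - 1)\<close>. Together with Minkowski's convex body theorem this gives
  \<open>box_point_from_pseudo_compound_point\<close>: the box \<open>\<bar>H $ i \<bullet> z\<bar> \<le> s $ i * \<eta> $ i\<close> contains a nonzero integer
  point as soon as \<open>norm s\<close> is smaller than the product of the \<open>s $ i\<close>.

  Now suppose that the second minimum of \<open>P\<close> exceeds \<open>c\<close>, where \<open>c\<close> is larger than the root. Then
  all integer points of the dilate of \<open>P\<close> by \<open>c\<close> lie on one line through the origin. Let \<open>u\<close> be a
  shortest nonzero one. Since the first minimum of \<open>P\<close> exceeds 1, \<open>u\<close> is not in \<open>P\<close>, so
  \<open>\<bar>H $ j \<bullet> u\<bar> > \<eta> $ j\<close> for some \<open>j\<close>, and this persists for every nonzero integer point of the dilate.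
  Hence the box with \<open>s $ j = 1\<close> and \<open>s $ i = c\<close> for all other \<open>i\<close> has no nonzero integer point. For this
  box, however, \<open>(norm s)\<^sup>2 = 1 + (d - 1) * c\<^sup>2\<close> and the product of the \<open>s $ i\<close> is \<open>c ^ (d - 1)\<close>, so the
  condition above reads \<open>(d - 1) * c\<^sup>2 + 1 < c ^ (2 * (d - 1))\<close>, which holds above the root.

  The section bound rests on two facts about \<open>X = (\<Sum>i. b $ i * U\<^sub>i)\<close> with independent \<open>U\<^sub>i\<close> uniform on
  \<open>(-1, 1)\<close>: its density is largest at the origin, and its variance is \<open>(norm b)\<^sup>2 / 3\<close>. A bounded
  density of given variance cannot be too small at its maximum
  (\<open>cube_slab_lower_bound\<close>). No sections or densities occur formally; they are represented by
  slabs and their volumes.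
\<close>

section \<open>Central slabs of the cube\<close>

definition symmetric_decreasing :: "(real \<Rightarrow> ennreal) \<Rightarrow> bool" where
  "symmetric_decreasing h \<longleftrightarrow> (\<forall>s t. \<bar>s\<bar> \<le> \<bar>t\<bar> \<longrightarrow> h t \<le> h s)"

lemma uniform_average_eq_window:
  fixes h :: "real \<Rightarrow> ennreal"
  assumes h[measurable]: "h \<in> borel_measurable borel" and b: "b \<noteq> 0"
  shows "(\<integral>\<^sup>+u. indicator {-1<..<1} u * h (t + b * u) \<partial>lborel) =
         ennreal (1 / \<bar>b\<bar>) * (\<integral>\<^sup>+w. h w * indicator {t - \<bar>b\<bar><..<t + \<bar>b\<bar>} w \<partial>lborel)"
proof -
  let ?f = "\<lambda>w. h w * indicator {t - \<bar>b\<bar><..<t + \<bar>b\<bar>} w"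
  have eq: "?f (t + b * u) = indicator {-1<..<1} u * h (t + b * u)" for u :: real
  proof -
    have "\<bar>b * u\<bar> < \<bar>b\<bar> \<longleftrightarrow> \<bar>u\<bar> < 1"
      using b by (simp add: abs_mult)
    then have "t + b * u \<in> {t - \<bar>b\<bar><..<t + \<bar>b\<bar>} \<longleftrightarrow> u \<in> {-1<..<1}"
      by auto
    then show ?thesis by (simp add: indicator_def mult.commute)
  qed
  have "(\<integral>\<^sup>+w. ?f w \<partial>lborel) = ennreal \<bar>b\<bar> * (\<integral>\<^sup>+u. ?f (t + b * u) \<partial>lborel)"
    by (rule nn_integral_real_affine[OF _ b]) measurable
  then have "ennreal (1 / \<bar>b\<bar>) * (\<integral>\<^sup>+w. ?f w \<partial>lborel) =
      (ennreal (1 / \<bar>b\<bar>) * ennreal \<bar>b\<bar>) * (\<integral>\<^sup>+u. ?f (t + b * u) \<partial>lborel)"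
    by (simp add: mult.assoc)
  also have "ennreal (1 / \<bar>b\<bar>) * ennreal \<bar>b\<bar> = 1"
    using b by (simp flip: ennreal_mult)
  finally show ?thesis by (simp only: eq mult_1)
qed

text \<open>
  The reflection \<open>w \<mapsto> s + t - w\<close> exchanges the two windows. It carries the part of the farther
  window outside the nearer one to points that are closer to the origin, where \<open>h\<close> is larger.
\<close>

lemma window_integral_mono:
  fixes h :: "real \<Rightarrow> ennreal"
  assumes h[measurable]: "h \<in> borel_measurable borel" and sd: "symmetric_decreasing h"
    and st: "0 \<le> s" "s \<le> t"
  shows "(\<integral>\<^sup>+w. h w * indicator {t - b<..<t + b} w \<partial>lborel)
       \<le> (\<integral>\<^sup>+w. h w * indicator {s - b<..<s + b} w \<partial>lborel)"
proof -
  let ?A = "{s - b<..<s + b}" and ?B = "{t - b<..<t + b}"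
  have refl: "(\<integral>\<^sup>+w. f w \<partial>lborel) = (\<integral>\<^sup>+w. f (s + t - w) \<partial>lborel)"
    if "f \<in> borel_measurable borel" for f :: "real \<Rightarrow> ennreal"
    using nn_integral_real_affine[OF that, of "-1" "s + t"] by simp
  have pw: "h w * indicator (?B - ?A) w \<le> h (s + t - w) * indicator (?A - ?B) (s + t - w)" for w
  proof (cases "w \<in> ?B - ?A")
    case True
    then have "s + t - w \<in> ?A - ?B" and "\<bar>s + t - w\<bar> \<le> \<bar>w\<bar>"
      using st by auto
    then show ?thesis
      using sd True by (simp add: symmetric_decreasing_def indicator_def)
  qed simp
  have split: "(\<integral>\<^sup>+w. h w * indicator X w \<partial>lborel) =
      (\<integral>\<^sup>+w. h w * indicator (X \<inter> Y) w \<partial>lborel) + (\<integral>\<^sup>+w. h w * indicator (X - Y) w \<partial>lborel)"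
    if [measurable]: "X \<in> sets borel" "Y \<in> sets borel" for X Y
    by (subst nn_integral_add[symmetric]) (auto intro!: nn_integral_cong simp: indicator_def)
  have "(\<integral>\<^sup>+w. h w * indicator (?B - ?A) w \<partial>lborel)
      \<le> (\<integral>\<^sup>+w. h (s + t - w) * indicator (?A - ?B) (s + t - w) \<partial>lborel)"
    by (intro nn_integral_mono pw)
  also have "\<dots> = (\<integral>\<^sup>+w. h w * indicator (?A - ?B) w \<partial>lborel)"
    by (rule refl[symmetric]) measurable
  finally show ?thesis
    using split[of ?A ?B] split[of ?B ?A] by (simp add: Int_commute add_left_mono)
qed

text \<open>
  Wintner's observation: averaging over a centred interval keeps symmetric unimodality. This
  elementary fact stands in for the Brunn--Minkowski inequality in the comparison of the central
  slab of a cube with its parallel translates.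
\<close>

lemma symmetric_decreasing_uniform_average:
  fixes h :: "real \<Rightarrow> ennreal"
  assumes h[measurable]: "h \<in> borel_measurable borel" and sd: "symmetric_decreasing h"
  shows "symmetric_decreasing (\<lambda>t. \<integral>\<^sup>+u. indicator {-1<..<1} u * h (t + b * u) \<partial>lborel)"
proof (cases "b = 0")
  case True
  then show ?thesis
    using sd by (auto simp: symmetric_decreasing_def intro!: nn_integral_mono mult_left_mono)
next
  case False
  let ?W = "\<lambda>t. \<integral>\<^sup>+w. h w * indicator {t - \<bar>b\<bar><..<t + \<bar>b\<bar>} w \<partial>lborel"
  have even: "h (- w) = h w" for w
    using sd by (intro antisym) (auto simp: symmetric_decreasing_def)
  have "?W (- t) = ?W t" for t
  proof -
    have "?W t = (\<integral>\<^sup>+w. h (- w) * indicator {t - \<bar>b\<bar><..<t + \<bar>b\<bar>} (- w) \<partial>lborel)"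
      using nn_integral_real_affine[of "\<lambda>w. h w * indicator {t - \<bar>b\<bar><..<t + \<bar>b\<bar>} w" "-1" 0] by simp
    also have "\<dots> = ?W (- t)"
      by (intro nn_integral_cong) (auto simp: even indicator_def)
    finally show ?thesis by simp
  qed
  then have abs: "?W t = ?W \<bar>t\<bar>" for t
    by (cases "0 \<le> t") (simp_all add: abs_if)
  have "?W t \<le> ?W s" if "\<bar>s\<bar> \<le> \<bar>t\<bar>" for s t
    using window_integral_mono[OF h sd abs_ge_zero that, of "\<bar>b\<bar>"] abs[of t] abs[of s] by simp
  then show ?thesis
    by (auto simp: symmetric_decreasing_def uniform_average_eq_window[OF h False] intro!: mult_left_mono)
qed

text \<open>
  For independent \<open>U\<^sub>i\<close> uniform on \<open>(-1, 1)\<close> this is \<open>2 ^ card I\<close> times the expectation of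
  \<open>h (t + (\<Sum>i\<in>I. b i * U\<^sub>i))\<close>. Without normalisation, the case of an indicator \<open>h\<close> is literally the
  volume of a slab of the cube.
\<close>

definition cube_integral ::
    "'i set \<Rightarrow> ('i \<Rightarrow> real) \<Rightarrow> (real \<Rightarrow> ennreal) \<Rightarrow> real \<Rightarrow> ennreal" where
  "cube_integral I b h t =
     (\<integral>\<^sup>+x. (\<Prod>i\<in>I. indicator {-1<..<1} (x i)) * h (t + (\<Sum>i\<in>I. b i * x i)) \<partial>(\<Pi>\<^sub>M i\<in>I. lborel))"

interpretation lborel_product: product_sigma_finite "\<lambda>_. lborel :: real measure"
  by standard

lemma cube_integral_empty [simp]: "cube_integral {} b h t = h t"
  by (simp add: cube_integral_def PiM_empty nn_integral_count_space_finite)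

lemma cube_integral_insert:
  assumes fin: "finite I" and i: "i \<notin> I" and h[measurable]: "h \<in> borel_measurable borel"
  shows "cube_integral (insert i I) b h t =
         (\<integral>\<^sup>+u. indicator {-1<..<1} u * cube_integral I b h (t + b i * u) \<partial>lborel)"
proof -
  let ?g = "\<lambda>J x. (\<Prod>j\<in>J. indicator {-1<..<1} (x j)) * h (t + (\<Sum>j\<in>J. b j * x j)) :: ennreal"
  have upd: "?g (insert i I) (x(i := u)) =
      indicator {-1<..<1} u *
        ((\<Prod>j\<in>I. indicator {-1<..<1} (x j)) * h (t + b i * u + (\<Sum>j\<in>I. b j * x j)))" for x u
  proof -
    have "(\<Prod>j\<in>I. indicator {-1<..<1} ((x(i := u)) j) :: ennreal) = (\<Prod>j\<in>I. indicator {-1<..<1} (x j))"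
      using i by (intro prod.cong) auto
    moreover have "(\<Sum>j\<in>I. b j * (x(i := u)) j) = (\<Sum>j\<in>I. b j * x j)"
      using i by (intro sum.cong) auto
    ultimately show ?thesis
      using fin i by (simp add: algebra_simps)
  qed
  have "cube_integral (insert i I) b h t =
      (\<integral>\<^sup>+u. (\<integral>\<^sup>+x. ?g (insert i I) (x(i := u)) \<partial>(\<Pi>\<^sub>M i\<in>I. lborel)) \<partial>lborel)"
    unfolding cube_integral_def
    by (rule lborel_product.product_nn_integral_insert_rev[OF fin i]) measurable
  also have "\<dots> = (\<integral>\<^sup>+u. indicator {-1<..<1} u * cube_integral I b h (t + b i * u) \<partial>lborel)"
    unfolding upd cube_integral_def
    by (intro nn_integral_cong nn_integral_cmult) measurable
  finally show ?thesis .
qed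

lemma borel_measurable_cube_integral:
  assumes fin: "finite I" and h[measurable]: "h \<in> borel_measurable borel"
  shows "cube_integral I b h \<in> borel_measurable borel"
proof -
  interpret sigma_finite_measure "\<Pi>\<^sub>M i\<in>I. (lborel :: real measure)"
    by (rule lborel_product.sigma_finite[OF fin])
  show ?thesis
    unfolding cube_integral_def by measurable
qed

lemma symmetric_decreasing_cube_integral:
  assumes "finite I" and "h \<in> borel_measurable borel" and "symmetric_decreasing h"
  shows "symmetric_decreasing (cube_integral I b h)"
  using assms
proof (induction I rule: finite_induct)
  case empty
  then show ?case by (simp add: symmetric_decreasing_def)
next
  case (insert i I)
  then show ?case
    using symmetric_decreasing_uniform_average[of "cube_integral I b h" "b i"]
    by (simp add: symmetric_decreasing_def cube_integral_insert borel_measurable_cube_integral)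
qed

lemma uniform_average_affine_square:
  fixes m t b :: real
  assumes "0 \<le> m"
  shows "(\<integral>\<^sup>+u. indicator {-1<..<1} u * ennreal ((t + b * u)\<^sup>2 + m) \<partial>lborel)
       = ennreal (2 * (t\<^sup>2 + b\<^sup>2 / 3 + m))"
proof -
  let ?F = "\<lambda>u. t\<^sup>2 * u + t * b * u\<^sup>2 + b\<^sup>2 * u ^ 3 / 3 + m * u"
  have "(\<integral>\<^sup>+u. ennreal ((t + b * u)\<^sup>2 + m) * indicator {-1..1} u \<partial>lborel) = ennreal (?F 1 - ?F (-1))"
  proof (rule nn_integral_FTC_Icc[where F = ?F])
    show "(?F has_real_derivative (t + b * u)\<^sup>2 + m) (at u)" for u
      by (auto intro!: derivative_eq_intros simp: power2_eq_square algebra_simps)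
  qed (use assms in auto)
  moreover have "(\<integral>\<^sup>+u. indicator {-1<..<1} u * ennreal ((t + b * u)\<^sup>2 + m) \<partial>lborel) =
      (\<integral>\<^sup>+u. ennreal ((t + b * u)\<^sup>2 + m) * indicator {-1..1} u \<partial>lborel)"
    by (rule nn_integral_cong_AE, rule eventually_mono[OF eventually_conj[OF
          AE_lborel_singleton[of 1] AE_lborel_singleton[of "-1"]]])
       (auto simp: indicator_def)
  ultimately show ?thesis by (simp add: algebra_simps)
qed

lemma cube_integral_square:
  assumes "finite I"
  shows "cube_integral I b (\<lambda>s. ennreal (s\<^sup>2)) t = ennreal (2 ^ card I * (t\<^sup>2 + (\<Sum>i\<in>I. (b i)\<^sup>2) / 3))"
  using assms
proof (induction I arbitrary: t rule: finite_induct)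
  case (insert i I)
  let ?m = "(\<Sum>i\<in>I. (b i)\<^sup>2) / 3"
  have m: "0 \<le> ?m" by (simp add: sum_nonneg)
  have meas: "(\<lambda>s::real. ennreal (s\<^sup>2)) \<in> borel_measurable borel" by measurable
  have "cube_integral (insert i I) b (\<lambda>s. ennreal (s\<^sup>2)) t =
      (\<integral>\<^sup>+u. ennreal (2 ^ card I) * (indicator {-1<..<1} u * ennreal ((t + b i * u)\<^sup>2 + ?m)) \<partial>lborel)"
    unfolding cube_integral_insert[OF insert.hyps(1,2) meas] insert.IH
    by (intro nn_integral_cong) (simp add: ennreal_mult' mult_ac)
  also have "\<dots> = ennreal (2 ^ card I) * ennreal (2 * (t\<^sup>2 + (b i)\<^sup>2 / 3 + ?m))"
    by (subst nn_integral_cmult) (simp_all add: uniform_average_affine_square[OF m])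
  also have "\<dots> = ennreal (2 ^ card (insert i I) * (t\<^sup>2 + (\<Sum>i\<in>insert i I. (b i)\<^sup>2) / 3))"
    using insert.hyps by (subst ennreal_mult'[symmetric]) (simp_all add: algebra_simps add_divide_distrib)
  finally show ?case .
qed simp

lemma cube_integral_const:
  assumes "finite I"
  shows "cube_integral I b (\<lambda>_. c) t = ennreal (2 ^ card I) * c"
  using assms
proof (induction I arbitrary: t rule: finite_induct)
  case (insert i I)
  have "(\<integral>\<^sup>+u. indicator {-1<..<1::real} u * (ennreal (2 ^ card I) * c) \<partial>lborel) = 2 * (ennreal (2 ^ card I) * c)"
    by (subst nn_integral_multc) simp_all
  then show ?case
    using insert by (simp add: cube_integral_insert ennreal_mult' mult_ac)
qed simp

lemma cube_integral_mono:
  assumes "\<And>s. g s \<le> h s"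
  shows "cube_integral I b g t \<le> cube_integral I b h t"
  unfolding cube_integral_def by (intro nn_integral_mono mult_left_mono assms) simp

lemma cube_integral_add:
  assumes [measurable]: "g \<in> borel_measurable borel" "h \<in> borel_measurable borel"
  shows "cube_integral I b (\<lambda>s. g s + h s) t = cube_integral I b g t + cube_integral I b h t"
  unfolding cube_integral_def distrib_left by (rule nn_integral_add) measurable

text \<open>
  For even functions the substitution \<open>t \<mapsto> - t - y\<close> exchanges \<open>g (t + y) * h t\<close> and \<open>g t * h (t + y)\<close>;
  integrate this over the values \<open>y\<close> of the sum \<open>\<Sum>i\<in>I. b i * x i\<close>.
\<close>

lemma cube_integral_adjoint:
  assumes fin: "finite I"
    and [measurable]: "g \<in> borel_measurable borel" "h \<in> borel_measurable borel"
    and even: "\<And>s. g (- s) = g s" "\<And>s. h (- s) = h s"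
  shows "(\<integral>\<^sup>+t. cube_integral I b g t * h t \<partial>lborel) = (\<integral>\<^sup>+t. g t * cube_integral I b h t \<partial>lborel)"
proof -
  let ?M = "\<Pi>\<^sub>M i\<in>I. (lborel :: real measure)"
  interpret M: sigma_finite_measure ?M by (rule lborel_product.sigma_finite[OF fin])
  interpret P: pair_sigma_finite lborel ?M ..
  define w :: "('a \<Rightarrow> real) \<Rightarrow> ennreal" where "w x = (\<Prod>i\<in>I. indicator {-1<..<1} (x i))" for x
  define Y where "Y x = (\<Sum>i\<in>I. b i * x i)" for x :: "'a \<Rightarrow> real"
  have [measurable]: "w \<in> borel_measurable ?M" "Y \<in> borel_measurable ?M"
    unfolding w_def Y_def by measurable
  have swap: "(\<integral>\<^sup>+t. p t * cube_integral I b q t \<partial>lborel) =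
      (\<integral>\<^sup>+x. w x * (\<integral>\<^sup>+t. p t * q (t + Y x) \<partial>lborel) \<partial>?M)"
    if [measurable]: "p \<in> borel_measurable borel" "q \<in> borel_measurable borel" for p q
  proof -
    have "(\<integral>\<^sup>+t. p t * cube_integral I b q t \<partial>lborel) =
        (\<integral>\<^sup>+t. (\<integral>\<^sup>+x. w x * (p t * q (t + Y x)) \<partial>?M) \<partial>lborel)"
      unfolding cube_integral_def w_def[symmetric] Y_def[symmetric]
      by (subst nn_integral_cmult[symmetric]) (auto intro!: nn_integral_cong simp: mult_ac)
    also have "\<dots> = (\<integral>\<^sup>+x. (\<integral>\<^sup>+t. w x * (p t * q (t + Y x)) \<partial>lborel) \<partial>?M)"
      by (rule P.Fubini'[symmetric]) measurable
    also have "\<dots> = (\<integral>\<^sup>+x. w x * (\<integral>\<^sup>+t. p t * q (t + Y x) \<partial>lborel) \<partial>?M)"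
      by (intro nn_integral_cong nn_integral_cmult) measurable
    finally show ?thesis .
  qed
  have refl: "(\<integral>\<^sup>+t. h t * g (t + y) \<partial>lborel) = (\<integral>\<^sup>+t. g t * h (t + y) \<partial>lborel)" for y
  proof -
    have "(\<integral>\<^sup>+t. h t * g (t + y) \<partial>lborel) = (\<integral>\<^sup>+t. h (- y + -1 * t) * g (- y + -1 * t + y) \<partial>lborel)"
      using nn_integral_real_affine[of "\<lambda>t. h t * g (t + y)" "-1" "- y"] by simp
    also have "\<dots> = (\<integral>\<^sup>+t. g t * h (t + y) \<partial>lborel)"
    proof (intro nn_integral_cong)
      fix t :: real
      have "- y + -1 * t = - (t + y)" "- y + -1 * t + y = - t" by simp_all
      then show "h (- y + -1 * t) * g (- y + -1 * t + y) = g t * h (t + y)"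
        by (simp only: even mult.commute)
    qed
    finally show ?thesis .
  qed
  have "(\<integral>\<^sup>+t. cube_integral I b g t * h t \<partial>lborel) = (\<integral>\<^sup>+t. h t * cube_integral I b g t \<partial>lborel)"
    by (simp only: mult.commute)
  then show ?thesis by (simp add: swap refl)
qed

text \<open>
  Hensley's variance argument. Let \<open>Y = (\<Sum>i\<in>I. b i * U\<^sub>i)\<close>, \<open>X = Y + b k * U\<^sub>k\<close> and \<open>\<alpha> = \<bar>b k\<bar>\<close>. The
  density of \<open>X\<close> at \<open>t\<close> is \<open>1 / (2\<alpha>)\<close> times the probability of \<open>\<bar>Y - t\<bar> < \<alpha>\<close>, which by unimodality is
  largest at \<open>t = 0\<close>, say \<open>M\<close>. A density bounded by \<open>M / (2\<alpha>)\<close> cannot have a variance smaller than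
  that of a uniform one of this height, whereas the variance of \<open>X\<close> is \<open>r\<^sup>2 / 3\<close>; hence \<open>M \<ge> \<alpha> / r\<close>.
  
  Quantitatively, \<open>r\<^sup>2 \<le> X\<^sup>2 + \<phi> X\<close> with \<open>\<phi> s\<close> the positive part of \<open>r\<^sup>2 - s\<^sup>2\<close>. Taking expectations
  bounds \<open>r\<^sup>2\<close> by \<open>r\<^sup>2 / 3 + M / (2\<alpha>) * (4 * r ^ 3 / 3)\<close>.
\<close>

lemma cube_slab_lower_bound:
  fixes b :: "'i \<Rightarrow> real"
  assumes fin: "finite I" and k: "k \<notin> I" and bk: "b k \<noteq> 0"
  defines "r \<equiv> sqrt (\<Sum>i\<in>insert k I. (b i)\<^sup>2)"
  shows "ennreal (2 ^ card I * (\<bar>b k\<bar> / r))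
       \<le> cube_integral I b (indicator {- \<bar>b k\<bar><..<\<bar>b k\<bar>}) 0"
proof -
  let ?J = "insert k I"
  let ?ind = "indicator {- \<bar>b k\<bar><..<\<bar>b k\<bar>} :: real \<Rightarrow> ennreal"
  \<comment> \<open>ennreal sends negative numbers to 0, so this is the positive part\<close>
  define \<phi> :: "real \<Rightarrow> ennreal" where "\<phi> s = ennreal (r\<^sup>2 - s\<^sup>2)" for s
  define G where "G = cube_integral I b ?ind 0"
  have [measurable]: "\<phi> \<in> borel_measurable borel"
    unfolding \<phi>_def by measurable
  have r2: "r\<^sup>2 = (\<Sum>i\<in>?J. (b i)\<^sup>2)"
    unfolding r_def by (simp add: sum_nonneg)
  have "0 < (\<Sum>i\<in>?J. (b i)\<^sup>2)"
    using fin bk by (intro sum_pos2[of _ k]) auto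
  then have r: "0 < r" by (simp add: r_def)
  have cJ: "card ?J = Suc (card I)" using fin k by simp
  have finJ: "finite ?J" using fin by simp

  have "ennreal (2 ^ card ?J * r\<^sup>2) = cube_integral ?J b (\<lambda>_. ennreal (r\<^sup>2)) 0"
    using finJ by (simp add: cube_integral_const ennreal_mult')
  also have "\<dots> \<le> cube_integral ?J b (\<lambda>s. ennreal (s\<^sup>2) + \<phi> s) 0"
  proof (rule cube_integral_mono)
    show "ennreal (r\<^sup>2) \<le> ennreal (s\<^sup>2) + \<phi> s" for s
    proof (cases "s\<^sup>2 \<le> r\<^sup>2")
      case True
      then show ?thesis by (simp add: \<phi>_def flip: ennreal_plus)
    next
      case False
      then have "ennreal (r\<^sup>2) \<le> ennreal (s\<^sup>2)" by (intro ennreal_leI) simp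
      then show ?thesis by (rule add_increasing2[OF zero_le])
    qed
  qed
  also have "\<dots> = ennreal (2 ^ card ?J * (r\<^sup>2 / 3)) + cube_integral ?J b \<phi> 0"
    by (simp add: cube_integral_add cube_integral_square[OF finJ] r2)
  also have "cube_integral ?J b \<phi> 0 \<le> ennreal (4 * r ^ 3 / (3 * \<bar>b k\<bar>)) * G"
  proof -
    have "cube_integral ?J b \<phi> 0 = (\<integral>\<^sup>+u. indicator {-1<..<1} u * cube_integral I b \<phi> (0 + b k * u) \<partial>lborel)"
      by (rule cube_integral_insert[OF fin k]) measurable
    also have "\<dots> = ennreal (1 / \<bar>b k\<bar>) * (\<integral>\<^sup>+w. cube_integral I b \<phi> w * ?ind w \<partial>lborel)"
      using uniform_average_eq_window[OF borel_measurable_cube_integral[OF fin] bk, of \<phi> b 0] by simp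
    also have "(\<integral>\<^sup>+w. cube_integral I b \<phi> w * ?ind w \<partial>lborel) = (\<integral>\<^sup>+w. \<phi> w * cube_integral I b ?ind w \<partial>lborel)"
      by (rule cube_integral_adjoint[OF fin]) (auto simp: \<phi>_def indicator_def)
    \<comment> \<open>unimodality: the slab through the origin is the heaviest\<close>
    also have "\<dots> \<le> (\<integral>\<^sup>+w. \<phi> w * G \<partial>lborel)"
    proof (intro nn_integral_mono mult_left_mono)
      have "symmetric_decreasing (cube_integral I b ?ind)"
        by (rule symmetric_decreasing_cube_integral[OF fin]) (auto simp: symmetric_decreasing_def indicator_def)
      then show "cube_integral I b ?ind w \<le> G" for w
        by (simp add: symmetric_decreasing_def G_def)
    qed simp
    also have "\<dots> = (\<integral>\<^sup>+w. \<phi> w \<partial>lborel) * G"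
      by (rule nn_integral_multc) measurable
    also have "(\<integral>\<^sup>+w. \<phi> w \<partial>lborel) = ennreal (4 * r ^ 3 / 3)"
    proof -
      let ?F = "\<lambda>w. r\<^sup>2 * w - w ^ 3 / 3"
      have "(\<integral>\<^sup>+w. \<phi> w \<partial>lborel) = (\<integral>\<^sup>+w. ennreal (r\<^sup>2 - w\<^sup>2) * indicator {-r..r} w \<partial>lborel)"
      proof (intro nn_integral_cong)
        show "\<phi> w = ennreal (r\<^sup>2 - w\<^sup>2) * indicator {-r..r} w" for w
        proof (cases "\<bar>w\<bar> \<le> r")
          case False
          then have "r\<^sup>2 \<le> w\<^sup>2" using r by (simp add: abs_le_square_iff[symmetric])
          then show ?thesis by (simp add: \<phi>_def ennreal_neg)
        qed (simp add: \<phi>_def abs_le_iff minus_le_iff)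
      qed
      also have "\<dots> = ennreal (?F r - ?F (-r))"
      proof (rule nn_integral_FTC_Icc[where F = ?F])
        show "(?F has_real_derivative r\<^sup>2 - w\<^sup>2) (at w)" for w
          by (auto intro!: derivative_eq_intros simp: power2_eq_square)
        show "0 \<le> r\<^sup>2 - w\<^sup>2" if "w \<in> {- r..r}" for w
        proof -
          have "\<bar>w\<bar> \<le> \<bar>r\<bar>" using that by auto
          then show ?thesis by (simp only: abs_le_square_iff diff_ge_0_iff_ge)
        qed
      qed (use r in auto)
      also have "?F r - ?F (-r) = 4 * r ^ 3 / 3"
        by (simp add: power2_eq_square power3_eq_cube)
      finally show ?thesis .
    qed
    finally have "cube_integral ?J b \<phi> 0 \<le> ennreal (1 / \<bar>b k\<bar>) * (ennreal (4 * r ^ 3 / 3) * G)"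
      by (simp add: mult_left_mono)
    also have "\<dots> = (ennreal (1 / \<bar>b k\<bar>) * ennreal (4 * r ^ 3 / 3)) * G"
      by (simp only: mult.assoc)
    also have "ennreal (1 / \<bar>b k\<bar>) * ennreal (4 * r ^ 3 / 3) = ennreal (4 * r ^ 3 / (3 * \<bar>b k\<bar>))"
      using r by (simp add: ennreal_mult[symmetric] mult.commute)
    finally show ?thesis .
  qed
  finally have main: "ennreal (2 ^ card ?J * r\<^sup>2)
      \<le> ennreal (2 ^ card ?J * (r\<^sup>2 / 3)) + ennreal (4 * r ^ 3 / (3 * \<bar>b k\<bar>)) * G"
    by (simp add: add_left_mono)
  show ?thesis
  proof (cases G)
    case (real g)
    have "ennreal (2 ^ card ?J * r\<^sup>2) \<le> ennreal (2 ^ card ?J * (r\<^sup>2 / 3) + 4 * r ^ 3 / (3 * \<bar>b k\<bar>) * g)"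
    proof -
      have "ennreal (4 * r ^ 3 / (3 * \<bar>b k\<bar>)) * G = ennreal (4 * r ^ 3 / (3 * \<bar>b k\<bar>) * g)"
        using real r by (subst ennreal_mult) auto
      then show ?thesis
        using main real r by (subst ennreal_plus) auto
    qed
    then have "2 ^ card ?J * r\<^sup>2 \<le> 2 ^ card ?J * (r\<^sup>2 / 3) + 4 * r ^ 3 / (3 * \<bar>b k\<bar>) * g"
      using real r by (subst (asm) ennreal_le_iff) auto
    then have "r\<^sup>2 * (2 ^ card I * (\<bar>b k\<bar> / r)) \<le> r\<^sup>2 * g"
      using r bk unfolding cJ by (simp add: field_simps power2_eq_square power3_eq_cube)
    then have "2 ^ card I * (\<bar>b k\<bar> / r) \<le> g"
      using r by (simp only: mult_le_cancel_left_pos zero_less_power)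
    then show ?thesis
      using real by (simp only: G_def[symmetric] ennreal_leI)
  qed (simp add: G_def[symmetric])
qed

lemma borel_measurable_vec_lambda:
  "(\<lambda>f. \<chi> i. f i) \<in> borel_measurable (\<Pi>\<^sub>M i\<in>(UNIV :: 'n::finite set). (lborel :: real measure))"
  by (subst borel_measurable_euclidean_space) (auto simp: Basis_vec_def inner_axis)

lemma distr_PiM_lborel_vec:
  "distr (\<Pi>\<^sub>M i\<in>(UNIV :: 'n::finite set). lborel) borel (\<lambda>f. \<chi> i. f i) = (lborel :: (real ^ 'n) measure)"
proof (rule lborel_eqI[symmetric])
  let ?M = "\<Pi>\<^sub>M i\<in>(UNIV :: 'n set). (lborel :: real measure)"
  note meas = borel_measurable_vec_lambda
  fix l u :: "real ^ 'n"
  assume "\<And>b. b \<in> Basis \<Longrightarrow> l \<bullet> b \<le> u \<bullet> b"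
  from this[of "axis i 1" for i] have le: "l $ i \<le> u $ i" for i
    by (simp add: inner_axis axis_in_Basis_iff)
  have "emeasure (distr ?M borel (\<lambda>f. \<chi> i. f i)) (box l u) =
      emeasure ?M (\<Pi>\<^sub>E i\<in>UNIV. {l $ i<..<u $ i})"
    using meas by (subst emeasure_distr) (auto simp: mem_box_cart space_PiM PiE_iff intro!: arg_cong[where f = "emeasure ?M"])
  also have "\<dots> = (\<Prod>i\<in>UNIV. ennreal (u $ i - l $ i))"
    using le by (subst lborel_product.emeasure_PiM) auto
  also have "\<dots> = ennreal (\<Prod>i\<in>UNIV. u $ i - l $ i)"
    using le by (simp add: prod_ennreal)
  also have "(\<Prod>i\<in>UNIV. u $ i - l $ i) = (\<Prod>b\<in>(Basis :: (real ^ 'n) set). (u - l) \<bullet> b)"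
  proof -
    have Basis: "(Basis :: (real ^ 'n) set) = range (\<lambda>i. axis i 1)"
      by (auto simp: Basis_vec_def)
    have "inj (\<lambda>i :: 'n. axis i (1 :: real))"
      by (auto simp: inj_on_def axis_eq_axis)
    then have "prod f (Basis :: (real ^ 'n) set) = (\<Prod>i\<in>UNIV. f (axis i 1))" for f :: "real ^ 'n \<Rightarrow> real"
      by (simp add: Basis prod.reindex)
    then show ?thesis by (simp add: inner_axis)
  qed
  finally show "emeasure (distr ?M borel (\<lambda>f. \<chi> i. f i)) (box l u) = ennreal (\<Prod>b\<in>Basis. (u - l) \<bullet> b)" .
qed simp

text \<open>
  Equivalently, the section of the cube \<open>(-1, 1)\<^sup>d\<close> by the hyperplane \<open>b \<bullet> y = 0\<close> has \<open>(d - 1)\<close>-volume at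
  least \<open>2 ^ (d - 1)\<close>: projecting the section along the \<open>k\<close>-th axis multiplies its volume by
  \<open>\<bar>b $ k\<bar> / norm b\<close>, and the set here is the product of that projection with an interval of length 2.
\<close>

lemma cube_slab_volume:
  fixes b :: "real ^ 'n"
  assumes bk: "b $ k \<noteq> 0"
  shows "ennreal (2 ^ CARD('n) * (\<bar>b $ k\<bar> / norm b))
       \<le> emeasure lborel {y :: real ^ 'n. (\<forall>i. \<bar>y $ i\<bar> < 1) \<and> \<bar>\<Sum>i\<in>-{k}. b $ i * y $ i\<bar> < \<bar>b $ k\<bar>}"
    (is "_ \<le> emeasure lborel ?D")
proof -
  let ?M = "\<Pi>\<^sub>M i\<in>(UNIV :: 'n set). (lborel :: real measure)"
  let ?I = "- {k}"
  let ?ind = "indicator {- \<bar>b $ k\<bar><..<\<bar>b $ k\<bar>} :: real \<Rightarrow> ennreal"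
  \<comment> \<open>with the k-th coefficient removed, the k-th coordinate only contributes the length 2\<close>
  define c where "c i = (if i = k then 0 else b $ i)" for i
  note meas = borel_measurable_vec_lambda
  have "open ?D"
    unfolding Collect_conj_eq Collect_all_eq
    by (intro open_Int open_INT finite ballI open_Collect_less continuous_intros)
  then have D: "?D \<in> sets borel" by simp
  have UNIV: "insert k ?I = UNIV" by auto
  have csum: "(\<Sum>i\<in>UNIV. c i * x i) = (\<Sum>i\<in>?I. b $ i * x i)" for x
  proof -
    have "(\<Sum>i\<in>insert k ?I. c i * x i) = (\<Sum>i\<in>?I. c i * x i)"
      by (subst sum.insert) (auto simp: c_def)
    also have "\<dots> = (\<Sum>i\<in>?I. b $ i * x i)"
      by (intro sum.cong) (auto simp: c_def)
    finally show ?thesis by (simp add: UNIV)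
  qed
  have "emeasure lborel ?D = (\<integral>\<^sup>+y. indicator ?D y \<partial>distr ?M borel (\<lambda>f. \<chi> i. f i))"
    using D by (simp add: distr_PiM_lborel_vec)
  also have "\<dots> = (\<integral>\<^sup>+x. indicator ?D (\<chi> i. x i) \<partial>?M)"
    using D by (intro nn_integral_distr meas) simp
  also have "\<dots> = cube_integral UNIV c ?ind 0"
    unfolding cube_integral_def csum
  proof (intro nn_integral_cong)
    fix x :: "'n \<Rightarrow> real"
    have "(\<Prod>i\<in>UNIV. indicator {-1<..<1} (x i) :: ennreal) = (if \<forall>i. \<bar>x i\<bar> < 1 then 1 else 0)"
      by (auto simp: indicator_def abs_less_iff minus_less_iff intro!: prod.neutral)
    then show "indicator ?D (\<chi> i. x i) =
        (\<Prod>i\<in>UNIV. indicator {-1<..<1} (x i)) * ?ind (0 + (\<Sum>i\<in>?I. b $ i * x i))"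
      by (auto simp: indicator_def abs_less_iff minus_less_iff)
  qed
  also have "\<dots> = cube_integral (insert k ?I) c ?ind 0"
    by (simp only: UNIV)
  also have "\<dots> = 2 * cube_integral ?I c ?ind 0"
    by (subst cube_integral_insert) (auto simp: c_def nn_integral_multc)
  also have "cube_integral ?I c ?ind 0 = cube_integral ?I (($) b) ?ind 0"
  proof -
    have "(\<Sum>i\<in>?I. c i * x i) = (\<Sum>i\<in>?I. b $ i * x i)" for x
      by (intro sum.cong) (auto simp: c_def)
    then show ?thesis unfolding cube_integral_def by simp
  qed
  finally have vol: "emeasure lborel ?D = 2 * cube_integral ?I (($) b) ?ind 0" .
  have "norm b = sqrt (\<Sum>i\<in>insert k ?I. (b $ i)\<^sup>2)"
    by (simp add: UNIV norm_vec_def L2_set_def)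
  then have "ennreal (2 ^ card ?I * (\<bar>b $ k\<bar> / norm b)) \<le> cube_integral ?I (($) b) ?ind 0"
    using cube_slab_lower_bound[of ?I k "($) b"] bk by simp
  then have "2 * ennreal (2 ^ card ?I * (\<bar>b $ k\<bar> / norm b)) \<le> emeasure lborel ?D"
    unfolding vol by (rule mult_left_mono) simp
  moreover have "CARD('n) = Suc (card ?I)"
    by (metis Compl_iff UNIV card_insert_disjoint finite insertI1)
  ultimately show ?thesis
    using ennreal_mult'[of 2 "2 ^ card ?I * (\<bar>b $ k\<bar> / norm b)"] by (simp add: mult.assoc)
qed

section \<open>Volumes of linear images\<close>

text \<open>
  Linear maps are compositions of diagonal maps, coordinate swaps, shears and maps with a vanishing
  component, and both scaling factors are multiplicative.
\<close>

theorem measure_linear_image_cart: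
  fixes f :: "real ^ 'n \<Rightarrow> real ^ 'n"
  assumes "linear f" "S \<in> lmeasurable"
  shows "measure lebesgue (f ` S) = \<bar>det (matrix f)\<bar> * measure lebesgue S"
proof -
  let ?P = "\<lambda>f :: real ^ 'n \<Rightarrow> real ^ 'n. linear f \<longrightarrow> (\<forall>S\<in>lmeasurable. f ` S \<in> lmeasurable \<and>
      measure lebesgue (f ` S) = \<bar>det (matrix f)\<bar> * measure lebesgue S)"
  have box: "?P f" if "\<And>a b. cbox a b \<noteq> {} \<Longrightarrow> measure lebesgue (f ` cbox a b) = measure lebesgue (cbox a b)"
    and "\<bar>det (matrix f)\<bar> = 1" for f :: "real ^ 'n \<Rightarrow> real ^ 'n"
  proof (intro impI ballI)
    fix S :: "(real ^ 'n) set" assume "linear f" "S \<in> lmeasurable"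
    have "measure lebesgue (f ` cbox a b) = 1 * measure lebesgue (cbox a b)" for a b
      using that(1)[of a b] by (cases "cbox a b = {}") auto
    then have "f ` S \<in> lmeasurable \<and> 1 * measure lebesgue S = measure lebesgue (f ` S)"
      by (rule measure_linear_sufficient[OF \<open>linear f\<close> \<open>S \<in> lmeasurable\<close>])
    then show "f ` S \<in> lmeasurable \<and> measure lebesgue (f ` S) = \<bar>det (matrix f)\<bar> * measure lebesgue S"
      using that(2) by simp
  qed
  have "?P f"
    using \<open>linear f\<close>
  proof (rule induct_linear_elementary)
    fix f g :: "real ^ 'n \<Rightarrow> real ^ 'n"
    assume lin: "linear f" "linear g" and P: "?P f" "?P g"
    show "?P (f \<circ> g)"
    proof (intro impI ballI)
      fix S :: "(real ^ 'n) set" assume S: "S \<in> lmeasurable"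
      have g: "g ` S \<in> lmeasurable" "measure lebesgue (g ` S) = \<bar>det (matrix g)\<bar> * measure lebesgue S"
        using P(2) lin(2) S by blast+
      have "f ` g ` S \<in> lmeasurable" "measure lebesgue (f ` g ` S) = \<bar>det (matrix f)\<bar> * measure lebesgue (g ` S)"
        using P(1) lin(1) g(1) by blast+
      then show "(f \<circ> g) ` S \<in> lmeasurable \<and>
          measure lebesgue ((f \<circ> g) ` S) = \<bar>det (matrix (f \<circ> g))\<bar> * measure lebesgue S"
        using g(2) by (simp only: image_comp matrix_compose[OF lin(2,1)] det_mul abs_mult mult.assoc)
    qed
  next
    fix f :: "real ^ 'n \<Rightarrow> real ^ 'n" and i
    assume lin: "linear f" and 0: "\<And>x. f x $ i = 0"
    have "det (matrix f) = 0"
      by (rule det_zero_row(1)[of i]) (simp add: matrix_def vec_eq_iff 0 row_def)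
    moreover have "negligible (f ` S)" for S
      by (rule negligible_subset[OF negligible_standard_hyperplane_cart[of i]]) (auto simp: 0)
    ultimately show "?P f"
      by (auto simp: negligible_iff_measure)
  next
    fix c :: "'n \<Rightarrow> real"
    have "det (matrix (\<lambda>x. \<chi> i. c i * x $ i)) = prod c UNIV"
      by (subst det_diagonal) (auto simp: matrix_def axis_def)
    then show "?P (\<lambda>x. \<chi> i. c i * x $ i)"
      by (simp add: measurable_stretch measure_stretch)
  next
    fix m n :: 'n assume "m \<noteq> n"
    let ?t = "Transposition.transpose m n"
    let ?f = "\<lambda>x :: real ^ 'n. \<chi> i. x $ ?t i"
    have lin: "linear ?f" by (rule linearI) (auto simp: vec_eq_iff)
    have "?f \<circ> ?f = id" by (auto simp: fun_eq_iff vec_eq_iff)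
    then have "matrix ?f ** matrix ?f = mat 1"
      using matrix_compose[OF lin lin] by (metis matrix_id_mat_1)
    then have "(det (matrix ?f))\<^sup>2 = 1"
      by (metis det_mul det_I power2_eq_square)
    then have "\<bar>det (matrix ?f)\<bar> = 1"
      by (simp only: abs_square_eq_1)
    moreover have "measure lebesgue (?f ` cbox a b) = measure lebesgue (cbox a b)"
      if ne: "cbox a b \<noteq> {}" for a b
    proof -
      have "?f ` cbox a b = cbox (?f a) (?f b)"
      proof (intro set_eqI iffI)
        fix y assume y: "y \<in> cbox (?f a) (?f b)"
        have "a $ i \<le> y $ ?t i \<and> y $ ?t i \<le> b $ i" for i
          using y[unfolded mem_box_cart, THEN spec, of "?t i"] by simp
        then have "?f y \<in> cbox a b"
          by (simp add: mem_box_cart)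
        then show "y \<in> ?f ` cbox a b"
          by (intro image_eqI[of _ _ "?f y"]) (auto simp: vec_eq_iff)
      qed (auto simp: mem_box_cart)
      moreover have "cbox (?f a) (?f b) \<noteq> {}"
        using ne by (simp add: interval_ne_empty_cart)
      moreover have "(\<Prod>i\<in>UNIV. b $ ?t i - a $ ?t i) = (\<Prod>i\<in>UNIV. b $ i - a $ i)"
        by (rule prod.reindex_bij_betw[of ?t]) simp
      ultimately show ?thesis
        using ne by (simp add: content_cbox_cart)
    qed
    ultimately show "?P ?f" by (rule box[rotated])
  next
    fix m n :: 'n assume mn: "m \<noteq> n"
    let ?f = "\<lambda>x :: real ^ 'n. \<chi> i. if i = m then x $ m + x $ n else x $ i"
    have lin: "linear ?f" by (rule linearI) (auto simp: vec_eq_iff algebra_simps)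
    have "matrix ?f = (\<chi> k. if k = m then row m (mat 1) + 1 *s row n (mat 1) else row k (mat 1))"
      by (auto simp: matrix_def vec_eq_iff row_def mat_def axis_def)
    then have "det (matrix ?f) = 1"
      using det_row_operation[OF mn, of "mat 1 :: real ^ 'n ^ 'n" 1] by simp
    moreover have "measure lebesgue (?f ` cbox a b) = measure lebesgue (cbox a b)"
      if ne: "cbox a b \<noteq> {}" for a b
    proof -
      \<comment> \<open>the shear of a box is known for nonnegative n-th coordinates; translate to reach that case\<close>
      let ?v = "axis n (- a $ n) :: real ^ 'n"
      have "measure lebesgue (?f ` cbox a b) = measure lebesgue ((+) (?f ?v) ` ?f ` cbox a b)"
        by (simp only: measure_translation)
      also have "(+) (?f ?v) ` ?f ` cbox a b = ?f ` (+) ?v ` cbox a b"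
        unfolding image_image by (rule image_cong[OF refl]) (rule linear_add[OF lin, symmetric])
      also have "(+) ?v ` cbox a b = cbox (?v + a) (?v + b)"
        by (rule cbox_translation[symmetric])
      also have "measure lebesgue (?f ` cbox (?v + a) (?v + b)) = measure lebesgue (cbox (?v + a) (?v + b))"
        using ne by (intro measure_shear_interval mn) (auto simp: cbox_translation axis_def)
      also have "\<dots> = measure lebesgue (cbox a b)"
        unfolding cbox_translation by (rule measure_translation)
      finally show ?thesis .
    qed
    ultimately show "?P ?f" by (intro box) auto
  qed
  then show ?thesis using assms by blast
qed

section \<open>Minkowski's convex body theorem\<close>

lemma finite_integer_lattice_box:
  "finite {x \<in> integer_lattice :: (real ^ 'n) set. \<forall>i. \<bar>x $ i\<bar> \<le> B}"
proof (rule finite_subset)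
  let ?K = "of_int ` {\<lfloor>- B\<rfloor>..\<lceil>B\<rceil>} :: real set"
  show "{x \<in> integer_lattice :: (real ^ 'n) set. \<forall>i. \<bar>x $ i\<bar> \<le> B} \<subseteq> (\<lambda>f. \<chi> i. f i) ` (\<Pi>\<^sub>E i\<in>UNIV. ?K)"
  proof
    fix x :: "real ^ 'n"
    assume x: "x \<in> {x \<in> integer_lattice. \<forall>i. \<bar>x $ i\<bar> \<le> B}"
    have "x $ i \<in> ?K" for i
    proof -
      have "x $ i \<in> \<int>" using x by (simp add: integer_lattice_def)
      then obtain m where m: "x $ i = of_int m" by (rule Ints_cases)
      have "\<bar>x $ i\<bar> \<le> B" using x by simp
      then have "- B \<le> of_int m" "of_int m \<le> B"
        unfolding m by linarith+
      then have "m \<in> {\<lfloor>- B\<rfloor>..\<lceil>B\<rceil>}"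
        by (simp add: floor_le_iff le_ceiling_iff)
      then show ?thesis using m by simp
    qed
    then show "x \<in> (\<lambda>f. \<chi> i. f i) ` (\<Pi>\<^sub>E i\<in>UNIV. ?K)"
      by (intro image_eqI[of _ _ "($) x"]) auto
  qed
  show "finite ((\<lambda>f. \<chi> i. f i) ` (\<Pi>\<^sub>E i\<in>(UNIV :: 'n set). ?K))"
    by (intro finite_imageI finite_PiE) auto
qed

lemma finite_bounded_integer_lattice:
  fixes S :: "(real ^ 'n) set"
  assumes "bounded S"
  shows "finite (S \<inter> integer_lattice)"
proof -
  obtain B where "\<And>x. x \<in> S \<Longrightarrow> norm x \<le> B"
    using assms by (auto simp: bounded_iff)
  then have "S \<inter> integer_lattice \<subseteq> {x \<in> integer_lattice. \<forall>i. \<bar>x $ i\<bar> \<le> B}"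
    using component_le_norm_cart order_trans by blast
  then show ?thesis using finite_integer_lattice_box finite_subset by blast
qed

lemma integer_lattice_diff:
  "x \<in> integer_lattice \<Longrightarrow> y \<in> integer_lattice \<Longrightarrow> x - y \<in> integer_lattice"
  by (simp add: integer_lattice_def)

text \<open>
  Cut \<open>S\<close> along the integer translates of the unit cell and move all pieces into that cell. If no two
  points of \<open>S\<close> differed by an integer vector, the moved pieces would be disjoint subsets of a set of
  volume 1.
\<close>

lemma blichfeldt:
  fixes S :: "(real ^ 'n) set"
  assumes S: "S \<in> lmeasurable" and bnd: "bounded S" and vol: "1 < measure lebesgue S"
  obtains x y where "x \<in> S" "y \<in> S" "x \<noteq> y" "x - y \<in> integer_lattice"
proof (rule ccontr)
  assume "\<not> thesis"
  then have no: "x = y" if "x \<in> S" "y \<in> S" "x - y \<in> integer_lattice" for x y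
    using \<open>\<And>x y. x \<in> S \<Longrightarrow> y \<in> S \<Longrightarrow> x \<noteq> y \<Longrightarrow> x - y \<in> integer_lattice \<Longrightarrow> thesis\<close> that by blast
  define fl :: "real ^ 'n \<Rightarrow> real ^ 'n" where "fl x = (\<chi> i. of_int \<lfloor>x $ i\<rfloor>)" for x
  define cell where "cell a = {x. fl x = a}" for a
  define A where "A = fl ` S"
  have flL: "fl x \<in> integer_lattice" for x
    by (simp add: fl_def integer_lattice_def)
  obtain B where B: "\<And>x. x \<in> S \<Longrightarrow> norm x \<le> B"
    using bnd by (auto simp: bounded_iff)
  have "A \<subseteq> {x \<in> integer_lattice. \<forall>i. \<bar>x $ i\<bar> \<le> B + 1}"
  proof -
    have "\<bar>of_int \<lfloor>x $ i\<rfloor>\<bar> \<le> B + 1" if "x \<in> S" for x i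
    proof -
      have "\<bar>x $ i\<bar> \<le> B" using B[OF that] component_le_norm_cart[of x i] by linarith
      then show ?thesis by linarith
    qed
    then have "\<bar>fl x $ i\<bar> \<le> B + 1" if "x \<in> S" for x i
      using that by (simp add: fl_def)
    then show ?thesis using flL by (auto simp: A_def simp del: abs_le_iff)
  qed
  then have finA: "finite A" using finite_integer_lattice_box finite_subset by blast
  have cell_meas: "cell a \<in> sets lebesgue" if "a \<in> integer_lattice" for a
  proof -
    have "cell a = {x. \<forall>i. a $ i \<le> x $ i \<and> x $ i < a $ i + 1}"
    proof (intro set_eqI)
      fix x
      have "of_int \<lfloor>x $ i\<rfloor> = a $ i \<longleftrightarrow> a $ i \<le> x $ i \<and> x $ i < a $ i + 1" for i
      proof -
        have "a $ i \<in> \<int>" using that by (simp add: integer_lattice_def)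
        then obtain m where m: "a $ i = of_int m" by (rule Ints_cases)
        show ?thesis unfolding m of_int_eq_iff by (rule floor_eq_iff)
      qed
      then show "x \<in> cell a \<longleftrightarrow> x \<in> {x. \<forall>i. a $ i \<le> x $ i \<and> x $ i < a $ i + 1}"
        by (simp only: cell_def fl_def mem_Collect_eq vec_eq_iff vec_lambda_beta)
    qed
    also have "\<dots> = (\<Inter>i. {x. a $ i \<le> x $ i} \<inter> {x. x $ i < a $ i + 1})"
      by auto
    also have "\<dots> \<in> sets borel"
      by (intro sets.finite_INT sets.Int borel_closed borel_open closed_Collect_le open_Collect_less continuous_intros) auto
    finally show ?thesis by auto
  qed
  define T where "T a = (+) (- a) ` (S \<inter> cell a)" for a
  have SM: "S \<inter> cell a \<in> lmeasurable" if "a \<in> A" for a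
    using that flL by (intro fmeasurable_Int_fmeasurable[OF S] cell_meas) (auto simp: A_def)
  have TM: "T a \<in> lmeasurable" if "a \<in> A" for a
    unfolding T_def using SM[OF that] by (rule measurable_translation)
  have "measure lebesgue S = measure lebesgue (\<Union>a\<in>A. S \<inter> cell a)"
    by (rule arg_cong[where f = "measure lebesgue"]) (auto simp: A_def cell_def)
  also have "\<dots> = (\<Sum>a\<in>A. measure lebesgue (S \<inter> cell a))"
  proof (intro measure_finite_Union[OF finA])
    show "disjoint_family_on (\<lambda>a. S \<inter> cell a) A"
      by (auto simp: disjoint_family_on_def cell_def)
  qed (use fmeasurableD[OF SM] fmeasurableD2[OF SM] in auto)
  also have "\<dots> = (\<Sum>a\<in>A. measure lebesgue (T a))"
    by (simp only: T_def measure_translation)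
  also have "\<dots> = measure lebesgue (\<Union>a\<in>A. T a)"
  proof (intro measure_finite_Union[OF finA, symmetric])
    show "disjoint_family_on T A"
      unfolding disjoint_family_on_def
    proof (intro ballI impI)
      fix a b assume ab: "a \<in> A" "b \<in> A" "a \<noteq> b"
      show "T a \<inter> T b = {}"
      proof (rule ccontr)
        assume "T a \<inter> T b \<noteq> {}"
        then obtain x y where xy: "x \<in> S" "fl x = a" "y \<in> S" "fl y = b" "- a + x = - b + y"
          by (auto simp: T_def cell_def)
        then have "x - y = fl x - fl y" by (simp add: algebra_simps)
        then have "x - y \<in> integer_lattice" using integer_lattice_diff[OF flL flL, of x y] by simp
        then show False using no xy ab by blast
      qed
    qed
  qed (use fmeasurableD[OF TM] fmeasurableD2[OF TM] in auto)
  also have "\<dots> \<le> measure lebesgue (cbox 0 (1 :: real ^ 'n))"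
  proof (intro measure_mono_fmeasurable)
    have "0 \<le> x $ i - of_int \<lfloor>x $ i\<rfloor> \<and> x $ i - of_int \<lfloor>x $ i\<rfloor> \<le> 1" for x :: "real ^ 'n" and i
      by linarith
    then show "(\<Union>a\<in>A. T a) \<subseteq> cbox 0 1"
      by (auto simp: T_def cell_def fl_def mem_box_cart)
    show "(\<Union>a\<in>A. T a) \<in> sets lebesgue"
      using TM finA by (intro sets.finite_UN) (auto simp: fmeasurable_def)
  qed auto
  also have "\<dots> = 1"
    by (subst measure_completion) (simp_all add: content_cbox_cart interval_ne_empty_cart)
  finally show False using vol by simp
qed

text \<open>
  Blichfeldt's lemma for the half-size copy of \<open>K\<close>: the difference of two points of that copy is
  again in \<open>K\<close>, by symmetry and convexity.
\<close>

theorem minkowski_convex_body: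
  fixes K :: "(real ^ 'n) set"
  assumes "convex K" and bnd: "bounded K" and sym: "\<And>x. x \<in> K \<Longrightarrow> - x \<in> K"
    and vol: "2 ^ CARD('n) < measure lebesgue K"
  obtains z where "z \<in> K" "z \<noteq> 0" "z \<in> integer_lattice"
proof -
  let ?f = "\<lambda>x :: real ^ 'n. \<chi> i. (1 / 2) * x $ i"
  have f: "?f x = (1 / 2) *\<^sub>R x" for x
    by (simp add: vec_eq_iff)
  have K: "K \<in> lmeasurable" using assms(1) bnd by (rule measurable_convex)
  have "?f ` K \<in> lmeasurable"
    by (rule measurable_stretch[OF K])
  moreover have "bounded (?f ` K)"
    unfolding f using bnd by (rule bounded_scaling)
  moreover have "measure lebesgue (?f ` K) = measure lebesgue K / 2 ^ CARD('n)"
    using measure_stretch[OF K, of "\<lambda>_. 1 / 2"] by (simp add: power_one_over)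
  with vol have "1 < measure lebesgue (?f ` K)"
    by simp
  ultimately obtain x y where "x \<in> ?f ` K" "y \<in> ?f ` K" and xy: "x \<noteq> y" "x - y \<in> integer_lattice"
    by (rule blichfeldt)
  then obtain p q where pq: "p \<in> K" "x = ?f p" "q \<in> K" "y = ?f q"
    by blast
  have "(1 / 2) *\<^sub>R p + (1 / 2) *\<^sub>R (- q) \<in> K"
    using sym pq by (intro convexD[OF \<open>convex K\<close>]) auto
  also have "(1 / 2) *\<^sub>R p + (1 / 2) *\<^sub>R (- q) = x - y"
    unfolding pq f by simp
  finally show ?thesis
    using xy by (intro that) auto
qed

section \<open>Successive minima of a parallelepiped\<close>

lemma bounded_form_body:
  assumes "invertible H"
  shows "bounded (form_body H \<eta>)"
proof -
  obtain B where B: "B ** H = mat 1" using assms by (auto simp: invertible_def)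
  have "form_body H \<eta> \<subseteq> (*v) B ` cbox (- \<eta>) \<eta>"
  proof
    fix z assume z: "z \<in> form_body H \<eta>"
    have "(H *v z) $ i = H $ i \<bullet> z" for i
      by (simp add: matrix_vector_mult_def inner_vec_def)
    then have "H *v z \<in> cbox (- \<eta>) \<eta>"
      using z by (simp add: mem_box_cart form_body_def abs_le_iff minus_le_iff)
    moreover have "z = B *v (H *v z)"
      by (simp add: matrix_vector_mul_assoc B)
    ultimately show "z \<in> (*v) B ` cbox (- \<eta>) \<eta>" by blast
  qed
  moreover have "bounded ((*v) B ` cbox (- \<eta>) \<eta>)"
    by (intro bounded_linear_image bounded_cbox matrix_vector_mul_bounded_linear)
  ultimately show ?thesis by (rule bounded_subset[rotated])
qed

lemma scale_form_body:
  assumes "0 < \<mu>"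
  shows "(*\<^sub>R) \<mu> ` form_body H \<eta> = form_body H (\<mu> *\<^sub>R \<eta>)"
proof (intro set_eqI iffI)
  fix z assume z: "z \<in> form_body H (\<mu> *\<^sub>R \<eta>)"
  have "(1 / \<mu>) *\<^sub>R z \<in> form_body H \<eta>"
    using z assms by (auto simp: form_body_def abs_mult field_simps)
  moreover have "z = \<mu> *\<^sub>R (1 / \<mu>) *\<^sub>R z" using assms by simp
  ultimately show "z \<in> (*\<^sub>R) \<mu> ` form_body H \<eta>" by blast
qed (use assms in \<open>auto simp: form_body_def abs_mult\<close>)

lemma form_body_mono:
  assumes "\<And>i. \<eta> $ i \<le> \<theta> $ i"
  shows "form_body H \<eta> \<subseteq> form_body H \<theta>"
  using assms order_trans by (fastforce simp: form_body_def)

text \<open>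
  The Minkowski functional of the parallelepiped: the least factor by which the body must be
  scaled to contain \<open>z\<close>.
\<close>

definition form_gauge :: "real ^ 'n ^ 'n \<Rightarrow> real ^ 'n \<Rightarrow> real ^ 'n \<Rightarrow> real" where
  "form_gauge H \<eta> z = (MAX i. \<bar>H $ i \<bullet> z\<bar> / \<eta> $ i)"

lemma form_gauge_le_iff:
  assumes "\<And>i. 0 < \<eta> $ i"
  shows "form_gauge H \<eta> z \<le> \<mu> \<longleftrightarrow> z \<in> form_body H (\<mu> *\<^sub>R \<eta>)"
  using assms by (simp add: form_gauge_def form_body_def pos_divide_le_eq)

lemma form_gauge_pos:
  assumes "invertible H" and "\<And>i. 0 < \<eta> $ i" and "z \<noteq> 0"
  shows "0 < form_gauge H \<eta> z"
proof (rule ccontr)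
  assume "\<not> 0 < form_gauge H \<eta> z"
  then have "z \<in> form_body H (0 *\<^sub>R \<eta>)"
    using form_gauge_le_iff[of \<eta> H z 0] assms(2) by simp
  then have "H *v z = 0"
    by (simp add: form_body_def vec_eq_iff matrix_vector_mult_def inner_vec_def)
  then show False
    using assms(1,3) by (metis invertible_def matrix_left_invertible_ker)
qed

lemma independent_integer_points:
  assumes "k \<le> CARD('n)"
  obtains S :: "(real ^ 'n) set" where "S \<subseteq> integer_lattice" "card S = k" "independent S"
proof -
  have "card (Basis :: (real ^ 'n) set) = CARD('n)"
    using DIM_cart[where 'a = real and 'b = 'n] by simp
  then obtain S where S: "S \<subseteq> (Basis :: (real ^ 'n) set)" "card S = k"
    using assms by (metis obtain_subset_with_card_n)
  moreover have "(Basis :: (real ^ 'n) set) \<subseteq> integer_lattice"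
    by (auto simp: Basis_vec_def integer_lattice_def axis_def)
  ultimately show ?thesis
    using that independent_mono[OF independent_Basis S(1)] by blast
qed

text \<open>
  A minimum over the real factors exists because it is one over finitely many candidates: only
  finitely many \<open>k\<close>-sets of integer points lie in a fixed multiple of the body, and each is reached
  exactly from the largest gauge of its points on. Thereby the minimum can be compared with \<open>c\<close> by
  looking at the integer points of a single multiple of the body.
\<close>

lemma successive_minimum_le_iff:
  fixes H :: "real ^ 'n ^ 'n"
  assumes H: "invertible H" and \<eta>: "\<And>i. 0 < \<eta> $ i" and k: "1 \<le> k" "k \<le> CARD('n)" and c: "0 < c"
  shows "successive_minimum k (form_body H \<eta>) integer_lattice \<le> c
     \<longleftrightarrow> (\<exists>S. S \<subseteq> form_body H (c *\<^sub>R \<eta>) \<inter> integer_lattice \<and> card S = k \<and> independent S)"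
proof -
  let ?L = "integer_lattice :: (real ^ 'n) set"
  let ?g = "form_gauge H \<eta>"
  let ?good = "\<lambda>\<mu>. \<exists>S. S \<subseteq> form_body H (\<mu> *\<^sub>R \<eta>) \<inter> ?L \<and> card S = k \<and> independent S"
  obtain S0 where S0: "S0 \<subseteq> ?L" "card S0 = k" "independent S0"
    using independent_integer_points[OF k(2)] .
  have fin: "finite S" "S \<noteq> {}" if "card S = k" for S :: "(real ^ 'n) set"
    using that k(1) by (auto intro: card_ge_0_finite)
  have Max_le: "Max (?g ` S) \<le> \<mu> \<longleftrightarrow> S \<subseteq> form_body H (\<mu> *\<^sub>R \<eta>)" if "card S = k" for S \<mu>
    using fin[OF that] form_gauge_le_iff[OF \<eta>, of H _ \<mu>] by auto
  \<comment> \<open>some factor at which the body does contain k independent integer points\<close>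
  define \<mu>0 where "\<mu>0 = Max (?g ` S0)"
  define F where "F = form_body H (\<mu>0 *\<^sub>R \<eta>) \<inter> ?L"
  define \<S> where "\<S> = {S. S \<subseteq> F \<and> card S = k \<and> independent S}"
  define m where "m = (MIN S\<in>\<S>. Max (?g ` S))"
  have "finite F"
    unfolding F_def by (intro finite_bounded_integer_lattice bounded_form_body H)
  then have fin\<S>: "finite \<S>"
    unfolding \<S>_def by (rule finite_subset[rotated, OF finite_Pow_iff[THEN iffD2]]) auto
  have S0\<S>: "S0 \<in> \<S>"
    using S0 Max_le[OF S0(2), of \<mu>0] by (auto simp: \<S>_def F_def \<mu>0_def)
  have m_le: "m \<le> \<mu>" if good: "?good \<mu>" for \<mu>
  proof -
    obtain S where S: "S \<subseteq> form_body H (\<mu> *\<^sub>R \<eta>) \<inter> ?L" "card S = k" "independent S"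
      using good by blast
    have le: "Max (?g ` S) \<le> \<mu>" using Max_le[OF S(2)] S(1) by blast
    show ?thesis
    proof (cases "\<mu> \<le> \<mu>0")
      case True
      then have "S \<subseteq> form_body H (\<mu>0 *\<^sub>R \<eta>)"
        using Max_le[OF S(2), of \<mu>0] le by simp
      then have "S \<in> \<S>" using S by (auto simp: \<S>_def F_def)
      then have "m \<le> Max (?g ` S)"
        unfolding m_def using fin\<S> by (intro Min_le) auto
      then show ?thesis using le by simp
    next
      case False
      have "m \<le> Max (?g ` S0)"
        unfolding m_def using fin\<S> S0\<S> by (intro Min_le) auto
      then show ?thesis using False by (simp add: \<mu>0_def)
    qed
  qed
  have "m \<in> (\<lambda>S. Max (?g ` S)) ` \<S>"
    unfolding m_def using fin\<S> S0\<S> by (intro Min_in) auto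
  then obtain S1 where S1: "S1 \<in> \<S>" "m = Max (?g ` S1)" by blast
  have good_ge: "?good \<mu>" if "m \<le> \<mu>" for \<mu>
    using Max_le[of S1 \<mu>] S1 that by (auto simp: \<S>_def F_def)
  have mpos: "0 < m"
  proof -
    have S1': "card S1 = k" "independent S1" using S1(1) by (auto simp: \<S>_def)
    then obtain x where x: "x \<in> S1" "x \<noteq> 0"
      using fin[OF S1'(1)] dependent_zero[of S1] by blast
    then have "0 < ?g x" using form_gauge_pos[OF H \<eta>] by blast
    also have "?g x \<le> m" using x S1(2) fin[OF S1'(1)] by simp
    finally show ?thesis .
  qed
  have "successive_minimum k (form_body H \<eta>) ?L = m"
    unfolding successive_minimum_def
  proof (rule Least_equality)
    show "0 < m \<and> (\<exists>S. S \<subseteq> (*\<^sub>R) m ` form_body H \<eta> \<inter> ?L \<and> card S = k \<and> independent S)"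
      using mpos good_ge[of m] by (simp add: scale_form_body)
    show "m \<le> y" if "0 < y \<and> (\<exists>S. S \<subseteq> (*\<^sub>R) y ` form_body H \<eta> \<inter> ?L \<and> card S = k \<and> independent S)" for y
      using that m_le[of y] scale_form_body[of y H \<eta>] by auto
  qed
  then show ?thesis using m_le good_ge by auto
qed

section \<open>Transference from the pseudo-compound\<close>

lemma dual_forms_matrix:
  assumes "dual_forms H H'"
  shows "H' ** transpose H = mat 1"
  using assms
  by (auto simp: dual_forms_def vec_eq_iff matrix_matrix_mult_def transpose_def inner_vec_def mat_def mult.commute)

lemma dual_forms_expansion:
  assumes "dual_forms H H'"
  shows "v = (\<Sum>i\<in>UNIV. (H' $ i \<bullet> v) *s row i H)"
proof -
  have "transpose H ** H' = mat 1"
    using dual_forms_matrix[OF assms] by (simp add: matrix_left_right_inverse)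
  then have "v = transpose H *v (H' *v v)" by (simp add: matrix_vector_mul_assoc)
  also have "\<dots> = (\<Sum>i\<in>UNIV. (H' *v v) $ i *s row i H)"
    by (simp only: matrix_mult_sum column_transpose)
  also have "\<dots> = (\<Sum>i\<in>UNIV. (H' $ i \<bullet> v) *s row i H)"
    by (simp only: matrix_vector_mul_component)
  finally show ?thesis .
qed

text \<open>
  Let \<open>y\<^sub>i = (H $ i \<bullet> z) / (s $ i * \<eta> $ i)\<close> be the coordinates in which the target box
  is the cube of side 2. Expanding \<open>v\<close> in the rows of \<open>H\<close> turns \<open>v \<bullet> z\<close> into \<open>b \<bullet> y\<close>, and membership of
  \<open>v\<close> in the pseudo-compound says \<open>\<bar>b $ i\<bar> \<le> N * s $ i\<close> with \<open>N\<close> the product of the \<open>\<eta> $ j\<close>; hence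
  \<open>norm b \<le> N * norm s\<close>.
  
  An integer point of the box that lies on \<open>v \<bullet> z = 0\<close> is found in full dimension. Pick \<open>k\<close> with
  \<open>b $ k \<noteq> 0\<close> and replace the coordinate \<open>y\<^sub>k\<close> by \<open>v \<bullet> z\<close>. Let \<open>K\<close> be the cylinder \<open>\<bar>v \<bullet> z\<bar> < 1\<close>
  over the projection along the \<open>k\<close>-th axis of the section of the cube. The slab bound
  \<open>cube_slab_volume\<close> and the hypothesis on \<open>s\<close> make its volume exceed \<open>2 ^ CARD('n)\<close>. In an integer
  point of \<open>K\<close> the integer \<open>v \<bullet> z\<close> vanishes, and then \<open>y\<^sub>k\<close> is recovered from the other coordinates.
\<close>

lemma box_point_from_pseudo_compound_point:
  fixes H H' :: "real ^ 'n ^ 'n" and \<eta> s v :: "real ^ 'n"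
  assumes H: "det H = 1" and dual: "dual_forms H H'"
    and \<eta>: "\<And>i. 0 < \<eta> $ i" and s: "\<And>i. 0 < s $ i"
    and v: "v \<in> form_body H' (\<chi> i. 1 / \<eta> $ i * (\<Prod>j\<in>UNIV. \<eta> $ j))"
    and vL: "v \<in> integer_lattice" and v0: "v \<noteq> 0"
    and size: "norm s < (\<Prod>i\<in>UNIV. s $ i)"
  obtains z where "z \<in> integer_lattice" "z \<noteq> 0" "z \<in> form_body H (\<chi> i. s $ i * \<eta> $ i)"
proof -
  define N where "N = (\<Prod>j\<in>UNIV. \<eta> $ j)"
  define c where "c i = 1 / (\<eta> $ i * s $ i)" for i
  define A where "A = (\<chi> i. c i *s H $ i)"
  define b :: "real ^ 'n" where "b = (\<chi> i. (H' $ i \<bullet> v) * (\<eta> $ i * s $ i))"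
  have pos: "0 < \<eta> $ i * s $ i" "0 < c i" for i
    using \<eta>[of i] s[of i] by (simp_all add: c_def)
  have N: "0 < N" unfolding N_def by (intro prod_pos) (simp add: \<eta>)
  have v_eq: "v = (\<Sum>i\<in>UNIV. b $ i *s row i A)"
  proof -
    have "b $ i *s row i A = (H' $ i \<bullet> v) *s row i H" for i
      using \<eta>[of i] s[of i] by (simp add: b_def A_def c_def row_def vec_eq_iff)
    then show ?thesis using dual_forms_expansion[OF dual, of v] by simp
  qed
  have b0: "b \<noteq> 0"
    using v_eq v0 by auto
  then obtain k where k: "b $ k \<noteq> 0" by (auto simp: vec_eq_iff)
  have norm_b: "norm b \<le> N * norm s"
  proof -
    have "\<bar>b $ i\<bar> \<le> \<bar>(N *\<^sub>R s) $ i\<bar>" for i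
    proof -
      have "\<bar>H' $ i \<bullet> v\<bar> \<le> 1 / \<eta> $ i * N"
        using v by (simp add: form_body_def N_def)
      then have "\<bar>H' $ i \<bullet> v\<bar> * (\<eta> $ i * s $ i) \<le> (1 / \<eta> $ i * N) * (\<eta> $ i * s $ i)"
        using pos(1)[of i] by (intro mult_right_mono) auto
      also have "\<dots> = N * s $ i" using \<eta>[of i] by simp
      finally show ?thesis
        using N s[of i] \<eta>[of i] by (simp add: b_def abs_mult)
    qed
    then have "norm b \<le> norm (N *\<^sub>R s)"
      by (intro norm_le_componentwise_cart) simp
    then show ?thesis using N by simp
  qed
  have Ai: "row i A \<bullet> z = c i * (H $ i \<bullet> z)" for i z
    by (simp add: A_def row_def inner_vec_def sum_distrib_left mult.assoc)
  have vz: "v \<bullet> z = (\<Sum>i\<in>UNIV. b $ i * (row i A \<bullet> z))" for z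
    by (subst v_eq) (simp add: inner_sum_left scalar_mult_eq_scaleR)

  \<comment> \<open>the coordinates y of z, with the k-th one replaced by the value of the form v\<close>
  define L where "L = (\<chi> i. if i = k then (\<Sum>i\<in>UNIV. b $ i *s row i A) else row i A)"
  have Lz: "(L *v z) $ i = (if i = k then v \<bullet> z else row i A \<bullet> z)" for z i
    by (simp add: matrix_vector_mul_component L_def flip: v_eq)
  have det_A: "det A = (\<Prod>i\<in>UNIV. c i)"
    unfolding A_def using det_rows_mul[of c "\<lambda>i. H $ i"] H by simp
  have det_L: "det L = b $ k * (\<Prod>i\<in>UNIV. c i)"
    unfolding L_def by (simp add: cramer_lemma_transpose det_A)
  have prod_c: "(\<Prod>i\<in>UNIV. c i) = 1 / (N * (\<Prod>i\<in>UNIV. s $ i))" and cpos: "0 < (\<Prod>i\<in>UNIV. c i)"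
    using pos(2) by (simp_all add: c_def N_def prod_dividef prod.distrib prod_pos \<eta> s)
  then have "det L \<noteq> 0" using k by (metis det_L mult_eq_0_iff less_irrefl)
  then obtain B where B: "L ** B = mat 1" "B ** L = mat 1"
    using invertible_det_nz[of L] by (auto simp: invertible_def)

  define D where "D = {y :: real ^ 'n. (\<forall>i. \<bar>y $ i\<bar> < 1) \<and> \<bar>\<Sum>i\<in>-{k}. b $ i * y $ i\<bar> < \<bar>b $ k\<bar>}"
  define K where "K = (*v) B ` D"
  have K_iff: "z \<in> K \<longleftrightarrow> L *v z \<in> D" for z
  proof
    assume "L *v z \<in> D"
    moreover have "z = B *v (L *v z)" by (simp add: matrix_vector_mul_assoc B)
    ultimately show "z \<in> K" unfolding K_def by blast
  qed (auto simp: K_def matrix_vector_mul_assoc B)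
  have LK: "(*v) L ` K = D"
    unfolding K_def image_image by (simp add: matrix_vector_mul_assoc B)
  have D_eq: "D = (\<Inter>i. (\<lambda>y. y $ i) -` {-1<..<1}) \<inter> (\<lambda>y. \<Sum>i\<in>-{k}. b $ i * y $ i) -` {- \<bar>b $ k\<bar><..<\<bar>b $ k\<bar>}"
    by (auto simp: D_def abs_less_iff minus_less_iff)
  have convD: "convex D"
    unfolding D_eq
    by (intro convex_Int convex_INT convex_linear_vimage convex_real_interval)
       (auto intro!: linearI simp: algebra_simps sum.distrib sum_distrib_left)
  have bndD: "bounded D"
  proof (rule bounded_subset[OF bounded_cbox[of "-1" 1]])
    have "- 1 \<le> t \<and> t \<le> 1" if "\<bar>t\<bar> < 1" for t :: real
      using that by linarith
    then show "D \<subseteq> cbox (- 1) 1"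
      by (auto simp: D_def mem_box_cart)
  qed
  have bndK: "bounded K"
    unfolding K_def using bndD by (intro bounded_linear_image matrix_vector_mul_bounded_linear)
  have convK: "convex K"
    unfolding K_def using convD by (intro convex_linear_image matrix_vector_mul_linear)
  have symK: "- z \<in> K" if "z \<in> K" for z
    using that by (simp add: K_iff D_def linear_neg[OF matrix_vector_mul_linear] sum_negf)

  have openD: "open D"
    unfolding D_def Collect_conj_eq Collect_all_eq
    by (intro open_Int open_INT finite ballI open_Collect_less continuous_intros)
  have volD: "2 ^ CARD('n) * (\<bar>b $ k\<bar> / norm b) \<le> measure lebesgue D"
  proof -
    have "emeasure lborel D = ennreal (measure lebesgue D)"
      using openD emeasure_bounded_finite[OF bndD] by (simp add: emeasure_eq_ennreal_measure)
    then show ?thesis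
      using cube_slab_volume[OF k] by (simp add: D_def[symmetric])
  qed
  have "measure lebesgue D = \<bar>det L\<bar> * measure lebesgue K"
    using measure_linear_image_cart[OF matrix_vector_mul_linear measurable_convex[OF convK bndK], of L]
    by (simp add: LK)
  then have volK: "2 ^ CARD('n) * (\<bar>b $ k\<bar> / norm b) \<le> \<bar>b $ k\<bar> * (\<Prod>i\<in>UNIV. c i) * measure lebesgue K"
    using volD cpos by (simp add: det_L abs_mult)
  have "2 ^ CARD('n) < measure lebesgue K"
  proof -
    have sp: "0 < (\<Prod>i\<in>UNIV. s $ i)" by (intro prod_pos) (simp add: s)
    have "norm b < N * (\<Prod>i\<in>UNIV. s $ i)"
      using norm_b mult_strict_left_mono[OF size N] by linarith
    then have "1 < N * (\<Prod>i\<in>UNIV. s $ i) / norm b"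
      using b0 by simp
    then have "2 ^ CARD('n) * 1 < 2 ^ CARD('n) * (N * (\<Prod>i\<in>UNIV. s $ i) / norm b)"
      by (intro mult_strict_left_mono) auto
    also have "\<dots> \<le> measure lebesgue K"
      using volK k b0 N sp by (simp add: prod_c field_simps)
    finally show ?thesis by simp
  qed
  then obtain z where z: "z \<in> K" "z \<noteq> 0" "z \<in> integer_lattice"
    using minkowski_convex_body[OF convK bndK symK] by blast
  define y where "y i = row i A \<bullet> z" for i
  have Dz: "\<bar>(L *v z) $ i\<bar> < 1" "\<bar>\<Sum>i\<in>-{k}. b $ i * (L *v z) $ i\<bar> < \<bar>b $ k\<bar>" for i
    using z(1) by (auto simp: K_iff D_def)
  \<comment> \<open>an integer of modulus less than 1 is zero, so z lies on the hyperplane orthogonal to v\<close>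
  have "v \<bullet> z \<in> \<int>"
    using vL z(3) by (auto simp: inner_vec_def integer_lattice_def intro!: Ints_sum Ints_mult)
  moreover have "\<bar>v \<bullet> z\<bar> < 1" using Dz(1)[of k] by (simp add: Lz)
  ultimately have "v \<bullet> z = 0" by (auto elim!: Ints_cases)
  moreover have "insert k (-{k}) = UNIV" by auto
  ultimately have "(\<Sum>i\<in>insert k (-{k}). b $ i * y i) = 0"
    by (simp only: vz y_def)
  then have "b $ k * y k = - (\<Sum>i\<in>-{k}. b $ i * y i)"
    by simp
  also have "(\<Sum>i\<in>-{k}. b $ i * y i) = (\<Sum>i\<in>-{k}. b $ i * (L *v z) $ i)"
    by (intro sum.cong) (auto simp: Lz y_def)
  finally have "\<bar>b $ k\<bar> * \<bar>y k\<bar> < \<bar>b $ k\<bar> * 1"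
    using Dz(2) by (simp add: abs_mult[symmetric])
  then have yk: "\<bar>y k\<bar> < 1"
    using k by (simp add: mult_less_cancel_left)
  have "\<bar>H $ i \<bullet> z\<bar> \<le> s $ i * \<eta> $ i" for i
  proof -
    have "\<bar>y i\<bar> \<le> 1"
      using yk Dz(1)[of i] by (cases "i = k") (simp_all add: Lz y_def)
    then show ?thesis
      using \<eta>[of i] s[of i] by (simp add: y_def Ai c_def abs_mult field_simps)
  qed
  then have "z \<in> form_body H (\<chi> i. s $ i * \<eta> $ i)"
    by (simp add: form_body_def)
  then show ?thesis using that z by blast
qed

lemma root_const_props:
  assumes "3 \<le> d"
  shows "0 < root_const d" and "root_const d ^ (2 * (d - 1)) = (real d - 1) * (root_const d)\<^sup>2 + 1"
  using theI'[OF root_const_ex1[OF assms]] unfolding root_const_def[symmetric] by simp_all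

text \<open>
  Above its root the defining polynomial is positive: scaling the argument by \<open>q > 1\<close> multiplies the
  leading term by more than \<open>q\<^sup>2\<close> and the remaining terms by at most \<open>q\<^sup>2\<close>.
\<close>

lemma above_root_const:
  assumes d: "3 \<le> d" and c: "root_const d < c"
  shows "1 < c" and "(real d - 1) * c\<^sup>2 + 1 < (c ^ (d - 1))\<^sup>2"
proof -
  define r where "r = root_const d"
  define q where "q = c / r"
  have r: "0 < r" and eq: "r ^ (2 * (d - 1)) = (real d - 1) * r\<^sup>2 + 1"
    using root_const_props[OF d] by (simp_all add: r_def)
  have q: "1 < q" and cq: "c = q * r"
    using r c by (simp_all add: q_def r_def)
  have "1 < r ^ (2 * (d - 1))" using eq r d by simp
  then have "1 < r" using r by (metis not_less power_le_one less_imp_le)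
  then show "1 < c" using c by (simp add: r_def)
  have "(real d - 1) * c\<^sup>2 + 1 \<le> q\<^sup>2 * ((real d - 1) * r\<^sup>2 + 1)"
    using q by (simp add: cq power_mult_distrib algebra_simps)
  also have "\<dots> < q ^ (2 * (d - 1)) * ((real d - 1) * r\<^sup>2 + 1)"
  proof (rule mult_strict_right_mono)
    show "q\<^sup>2 < q ^ (2 * (d - 1))" using q d by (intro power_strict_increasing) auto
    show "0 < (real d - 1) * r\<^sup>2 + 1" using d by (simp add: add_nonneg_pos)
  qed
  also have "\<dots> = (c ^ (d - 1))\<^sup>2"
    by (simp add: eq[symmetric] cq power_mult_distrib flip: power_mult) (simp add: mult.commute)
  finally show "(real d - 1) * c\<^sup>2 + 1 < (c ^ (d - 1))\<^sup>2" .
qed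

theorem theorem2:
  fixes P Q :: "(real ^ 'n) set"
  assumes "3 \<le> CARD('n)"
    and "symmetric_parallelepiped P"
    and "is_pseudo_compound P Q"
    and "successive_minimum 1 Q integer_lattice \<le> 1"
    and "successive_minimum 1 P integer_lattice > 1"
  shows "successive_minimum 2 P integer_lattice \<le> root_const CARD('n)"
proof (rule ccontr)
  let ?L = "integer_lattice :: (real ^ 'n) set"
  let ?r = "root_const CARD('n)"
  assume large: "\<not> successive_minimum 2 P ?L \<le> ?r"
  obtain H \<eta> H' where H: "det H = 1" and \<eta>: "\<And>i. 0 < \<eta> $ i" and P: "P = form_body H \<eta>"
    and dual: "dual_forms H H'" and Q: "Q = form_body H' (\<chi> i. 1 / \<eta> $ i * (\<Prod>j\<in>UNIV. \<eta> $ j))"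
    using assms(3) unfolding is_pseudo_compound_def by blast
  have invH: "invertible H" using H by (simp add: invertible_det_nz)
  have invH': "invertible H'"
    using dual_forms_matrix[OF dual] by (auto simp: invertible_right_inverse)
  have \<eta>': "0 < (\<chi> i. 1 / \<eta> $ i * (\<Prod>j\<in>UNIV. \<eta> $ j)) $ i" for i
    using \<eta> by (simp add: prod_pos)
  have card: "1 \<le> CARD('n)" "2 \<le> CARD('n)" using assms(1) by simp_all

  have "\<exists>S. S \<subseteq> form_body H' (1 *\<^sub>R (\<chi> i. 1 / \<eta> $ i * (\<Prod>j\<in>UNIV. \<eta> $ j))) \<inter> ?L \<and> card S = 1 \<and> independent S"
    using assms(4) successive_minimum_le_iff[OF invH' \<eta>' order_refl card(1) zero_less_one] unfolding Q by blast
  then obtain v where v: "v \<in> Q" "v \<in> ?L" "v \<noteq> 0"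
    by (auto simp: Q card_1_singleton_iff)
  have noP: "u \<notin> P" if "u \<in> ?L" "u \<noteq> 0" for u
  proof
    assume "u \<in> P"
    then have "{u} \<subseteq> form_body H (1 *\<^sub>R \<eta>) \<inter> ?L \<and> card {u} = 1 \<and> independent {u}"
      using that by (simp add: P)
    then show False
      using assms(5) successive_minimum_le_iff[OF invH \<eta> order_refl card(1) zero_less_one]
      unfolding P by (meson not_le)
  qed

  define c where "c = (?r + successive_minimum 2 P ?L) / 2"
  have c: "?r < c" "c < successive_minimum 2 P ?L"
    using large by (simp_all add: c_def)
  note c1 = above_root_const[OF assms(1) c(1)]
  let ?F = "form_body H (c *\<^sub>R \<eta>) \<inter> ?L - {0}"
  have line: "dependent {x, y}" if "x \<in> ?F" "y \<in> ?F" "x \<noteq> y" for x y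
  proof (rule ccontr)
    assume "independent {x, y}"
    then have "{x, y} \<subseteq> form_body H (c *\<^sub>R \<eta>) \<inter> ?L \<and> card {x, y} = 2 \<and> independent {x, y}"
      using that by simp
    then show False
      using c successive_minimum_le_iff[OF invH \<eta> _ card(2), of c] c1(1) unfolding P
      by (smt (verit) one_le_numeral)
  qed

  \<comment> \<open>the box keeps the width of P in direction j and is scaled by c in all others\<close>
  have slice: "\<exists>z\<in>?F. \<bar>H $ j \<bullet> z\<bar> \<le> \<eta> $ j" for j
  proof -
    define s :: "real ^ 'n" where "s = (\<chi> i. if i = j then 1 else c)"
    have s: "0 < s $ i" "s $ i \<le> c" for i using c1(1) by (simp_all add: s_def)
    have cmpl: "card (- {j}) = CARD('n) - 1" and ins: "UNIV = insert j (- {j})"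
      by (auto simp: Compl_eq_Diff_UNIV card_Diff_singleton)
    have "(norm s)\<^sup>2 = (\<Sum>i\<in>insert j (- {j}). (s $ i)\<^sup>2)"
      by (simp add: norm_vec_def L2_set_def sum_nonneg flip: ins)
    also have "\<dots> = 1 + (\<Sum>i\<in>- {j}. c\<^sup>2)"
      by (subst sum.insert) (auto simp: s_def intro!: sum.cong)
    also have "\<dots> = (real CARD('n) - 1) * c\<^sup>2 + 1"
      using card(1) by (simp add: cmpl of_nat_diff)
    also have "\<dots> < (c ^ (CARD('n) - 1))\<^sup>2" by (rule c1(2))
    also have "c ^ (CARD('n) - 1) = (\<Prod>i\<in>insert j (- {j}). s $ i)"
      by (subst prod.insert) (auto simp: s_def cmpl)
    finally have "norm s < (\<Prod>i\<in>UNIV. s $ i)"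
      using s(1) by (auto simp flip: ins intro: power2_less_imp_less prod_nonneg less_imp_le)
    from box_point_from_pseudo_compound_point[OF H dual \<eta> s(1) v(1)[unfolded Q] v(2,3) this]
    obtain z where z: "z \<in> ?L" "z \<noteq> 0" "z \<in> form_body H (\<chi> i. s $ i * \<eta> $ i)" .
    have "form_body H (\<chi> i. s $ i * \<eta> $ i) \<subseteq> form_body H (c *\<^sub>R \<eta>)"
      using s(2) \<eta> by (intro form_body_mono) (simp add: mult_right_mono less_imp_le)
    moreover have "\<bar>H $ j \<bullet> z\<bar> \<le> \<eta> $ j"
      using z(3) by (auto simp: form_body_def s_def dest: spec[of _ j])
    ultimately show ?thesis using z by blast
  qed
  \<comment> \<open>on a line, the other points are multiples of a shortest one by factors of modulus at least 1\<close>
  have "finite ?F" "?F \<noteq> {}"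
    using finite_bounded_integer_lattice[OF bounded_form_body[OF invH]] slice by auto
  then obtain u where u: "u \<in> ?F" and min: "\<And>x. x \<in> ?F \<Longrightarrow> norm u \<le> norm x"
    using ex_is_arg_min_if_finite[of ?F norm] by (auto simp: is_arg_min_linorder)
  then obtain j where j: "\<eta> $ j < \<bar>H $ j \<bullet> u\<bar>"
    using noP[of u] by (auto simp: P form_body_def not_le)
  obtain z where z: "z \<in> ?F" "\<bar>H $ j \<bullet> z\<bar> \<le> \<eta> $ j" using slice by blast
  then have "u \<noteq> z" using j by auto
  then have "z \<in> span {u}"
    using line[OF z(1) u] independent_insertI[of z "{u}"] u by auto
  then obtain t where t: "z = t *\<^sub>R u" by (auto simp: span_singleton)
  have "norm u \<le> \<bar>t\<bar> * norm u" using min[OF z(1)] by (simp add: t)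
  then have "1 \<le> \<bar>t\<bar>" using u by simp
  then have "\<bar>H $ j \<bullet> u\<bar> \<le> \<bar>t\<bar> * \<bar>H $ j \<bullet> u\<bar>"
    by (simp add: mult_le_cancel_right1)
  also have "\<dots> \<le> \<eta> $ j" using z(2) by (simp add: t abs_mult)
  finally show False using j by simp
qed

end
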